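(* For every integer $n\ge1$ and every integer $r\ge4$, $$f(n,r,4)=\begin{cases} 3n-\left\lceil\frac{2n}{3}\right\rceil, & r=4,\\[2mm] \frac{2r}{3}\,n, & r\ge6\text{ and }r\equiv0\pmod 3,\\[2mm] \left(r-\left\lceil\frac r3\right\rceil\right)n, & r\equiv2\pmod 3,\\[2mm] (r-1)n-\left\lceil\frac{(m-1)(r-1)n}{r}\right\rceil-\eta(n,r), & r=3m-2\equiv1\pmod 3,\ r\ge7, \end{cases}$$ where in the last line $m\ge3$ is the integer with $r=3m-2$.
   Context: A balanced $r$-partite graph with parts of size $n$ is a simple graph whose vertex set is partitioned into $r$ independent sets, each of size $n$. $f(n,r,4)$ denotes the largest possible minimum degree of a balanced $r$-partite graph with parts of size $n$ that contains no copy of the complete graph $K_4$. For $r=3m-2$ with $m\ge3$, write $n=qr+\rho$ with integers $q\ge 0$ and $0\le\rho<r$. Define $\eta(n,r)=1$ if there is an integer $h$ with $1\le h\le m-2$, $\rho=3h+1$ and $(q+1)\nmid(m-h-1)$; otherwise define $\eta(n,r)=0$. *)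

theory Defs
  imports Complex_Main "HOL-Library.Disjoint_Sets" "HOL-Number_Theory.Cong"
begin

definition simple_graph :: "'a set \<Rightarrow> 'a set set \<Rightarrow> bool" where
  "simple_graph V E \<longleftrightarrow> finite V \<and> (\<forall>e\<in>E. e \<subseteq> V \<and> card e = 2)"

definition independent_set :: "'a set set \<Rightarrow> 'a set \<Rightarrow> bool" where
  "independent_set E A \<longleftrightarrow> (\<forall>u\<in>A. \<forall>v\<in>A. {u, v} \<notin> E)"

definition balanced_multipartite :: "nat \<Rightarrow> nat \<Rightarrow> 'a set \<Rightarrow> 'a set set \<Rightarrow> bool" where
  "balanced_multipartite n r V E \<longleftrightarrow> simple_graph V E \<and>
     (\<exists>P. partition_on V P \<and> card P = r \<and> (\<forall>A\<in>P. card A = n \<and> independent_set E A))"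

definition contains_complete :: "nat \<Rightarrow> 'a set \<Rightarrow> 'a set set \<Rightarrow> bool" where
  "contains_complete t V E \<longleftrightarrow>
     (\<exists>K\<subseteq>V. card K = t \<and> (\<forall>u\<in>K. \<forall>v\<in>K. u \<noteq> v \<longrightarrow> {u, v} \<in> E))"

definition vertex_degree :: "'a set set \<Rightarrow> 'a \<Rightarrow> nat" where
  "vertex_degree E v = card {e \<in> E. v \<in> e}"

definition min_degree :: "'a set \<Rightarrow> 'a set set \<Rightarrow> nat" where
  "min_degree V E = Min (vertex_degree E ` V)"

text \<open>The function \<open>f(n, r, t)\<close>. Every finite graph is isomorphic to one whose vertices are
  natural numbers, so letting \<open>V\<close> range over sets of naturals loses no generality.
  For \<open>n, r \<ge> 1\<close> and \<open>t \<ge> 2\<close> the set below is finite and nonempty.\<close>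

definition max_min_degree :: "nat \<Rightarrow> nat \<Rightarrow> nat \<Rightarrow> nat" where
  "max_min_degree n r t =
     Max {min_degree V E | (V :: nat set) E.
            balanced_multipartite n r V E \<and> \<not> contains_complete t V E}"

text \<open>Here \<open>q = n div r\<close> and \<open>\<rho> = n mod r\<close>; the bounds on \<open>m\<close> and \<open>h\<close> ensure that no natural-number
  subtraction truncates.\<close>

definition eta :: "nat \<Rightarrow> nat \<Rightarrow> nat" where
  "eta n r =
     (if \<exists>m h. m \<ge> 3 \<and> r = 3 * m - 2 \<and> 1 \<le> h \<and> h \<le> m - 2 \<and>
           n mod r = 3 * h + 1 \<and> \<not> (n div r + 1) dvd (m - h - 1)
      then 1 else 0)"

end

(* For r = 4, a K4 is an independent transversal of the non-adjacency graph between different parts,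
   and Haxell's theorem decides when one exists. For r >= 5 a minimum degree above the claimed value
   exceeds 3/5 of the number of vertices, so by a theorem of Goddard and Lyle some independent set
   meets every triangle. Comparing degrees inside and outside this set, part by part, gives the bound
   for r = 2 mod 3; for r = 3m - 2 it forces a proper 3-colouring. What remains is an optimisation over
   the matrix of sizes of (colour class) \<inter> (part). The optimum has a column shared with both
   others, the shared rows being nearly equal, and eta records when integrality spoils the equality.
   The extremal matrices also supply the constructions. *)

theory Submission
  imports Defs
begin

section \<open>Dense graphs without \<open>K\<^sub>4\<close>\<close>

text \<open>Why \<open>r = 4\<close> stands apart: its value is about 7n/3, below 3/5 of the 4n
  vertices. For \<open>r = 5\<close> the value 3n is exactly 3/5, so any excess just suffices.

  Where \<open>eta\<close> comes from: let \<open>r = 3 * M + 1\<close> and let the minimum degree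
  be \<open>2 * M * n + e\<close>. A colour class with s vertices, x > 0 of them in a given part,
  satisfies s + e <= M n + x. In the critical configuration two columns share no row and each
  occupies M + 1 rows. In each of these two blocks the third column has sum at least e plus its
  largest entry there; over both blocks together its sum is at most n - e plus its smallest positive
  entry. So each of the two largest entries lies between e/M and n - 3e, whence (3M+1)e <= Mn. If c
  = n - 3e and no integer below c reaches e/M, all positive entries are forced to equal c; each
  block sums to e + c, so c divides e. For e = Mq + h and c = q + 1 we have e + (M - h) = M c, so
  this says that q + 1 divides M - h = m - h - 1.\<close>

locale fin_graph =
  fixes V :: "'a set" and G :: "'a \<Rightarrow> 'a \<Rightarrow> bool"
  assumes finite_V: "finite V"
    and G_in: "G u v \<Longrightarrow> u \<in> V"
    and G_sym: "G u v \<Longrightarrow> G v u"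
    and G_irrefl: "\<not> G v v"
begin

lemma G_in2: "G u v \<Longrightarrow> v \<in> V"
  using G_in G_sym by blast

definition nb :: "'a \<Rightarrow> 'a set" where "nb v = {u. G v u}"

lemma nb_subset: "nb v \<subseteq> V"
  using G_in G_sym unfolding nb_def by blast

lemma finite_nb [simp]: "finite (nb v)"
  using nb_subset finite_V finite_subset by blast

lemma mem_nb [simp]: "u \<in> nb v \<longleftrightarrow> G v u"
  by (simp add: nb_def)

text \<open>Double counting over a list instead of a set, so that a vertex can be given a larger
  weight by repeating it.\<close>

lemma sum_hits: "(\<Sum>u\<in>V. length (filter (G u) xs)) = (\<Sum>x\<leftarrow>xs. card (nb x))"
proof (induction xs)
  case (Cons x xs)
  have "(\<Sum>u\<in>V. length (filter (G u) (x # xs))) =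
      (\<Sum>u\<in>V. (if u \<in> nb x then 1 else 0) + length (filter (G u) xs))"
    by (rule sum.cong) (auto dest: G_sym)
  also have "\<dots> = card (nb x) + (\<Sum>u\<in>V. length (filter (G u) xs))"
    using nb_subset[of x] finite_V
    by (simp add: sum.distrib sum.If_cases Int_absorb1 nb_def)
  finally show ?case using Cons.IH by simp
qed simp

lemma pigeonhole:
  assumes "c * card V < (\<Sum>x\<leftarrow>xs. card (nb x))"
  shows "\<exists>u\<in>V. c < length (filter (G u) xs)"
proof (rule ccontr)
  assume "\<not> ?thesis"
  then have "(\<Sum>u\<in>V. length (filter (G u) xs)) \<le> card V * c"
    using sum_bounded_above[of V "\<lambda>u. length (filter (G u) xs)" c] by (force simp: not_less)
  then show False using assms sum_hits[of xs] by (simp add: mult.commute)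
qed

lemma card_nb_Int: "card (nb x) + card (nb y) \<le> card V + card (nb x \<inter> nb y)"
proof -
  have "card (nb x \<union> nb y) \<le> card V" using nb_subset finite_V by (simp add: card_mono)
  then show ?thesis using card_Un_Int[of "nb x" "nb y"] by simp
qed

end

locale K4_free_graph = fin_graph +
  assumes no_K4: "G a b \<Longrightarrow> G a c \<Longrightarrow> G a d \<Longrightarrow> G b c \<Longrightarrow> G b d \<Longrightarrow> G c d \<Longrightarrow> False"

section \<open>Five-wheels in graphs with minimum degree above 3/5 of the order\<close>

locale dense_K4_free_graph = K4_free_graph +
  assumes dense: "v \<in> V \<Longrightarrow> 3 * card V < 5 * card (nb v)"
begin

lemma dense_pigeonhole:
  assumes "set xs \<subseteq> V" "xs \<noteq> []"
  shows "\<exists>u\<in>V. 3 * length xs < 5 * length (filter (G u) xs)"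
proof (rule ccontr)
  assume neg: "\<not> ?thesis"
  have "set xs \<subseteq> V \<Longrightarrow> xs \<noteq> [] \<Longrightarrow> 3 * length xs * card V < 5 * (\<Sum>x\<leftarrow>xs. card (nb x))"
  proof (induction xs)
    case (Cons x xs)
    then show ?case using dense[of x] by (cases "xs = []") (auto simp: algebra_simps)
  qed simp
  with assms have "3 * length xs * card V < 5 * (\<Sum>u\<in>V. length (filter (G u) xs))"
    using sum_hits by metis
  also have "\<dots> = (\<Sum>u\<in>V. 5 * length (filter (G u) xs))" by (simp add: sum_distrib_left)
  also have "\<dots> \<le> card V * (3 * length xs)"
    using neg sum_bounded_above[of V "\<lambda>u. 5 * length (filter (G u) xs)" "3 * length xs"]
    by (force simp: not_less)
  finally show False by simp
qed

lemma independent_card: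
  assumes "S \<subseteq> V" "\<And>u v. u \<in> S \<Longrightarrow> v \<in> S \<Longrightarrow> \<not> G u v"
  shows "5 * card S \<le> 2 * card V"
proof (cases "S = {}")
  case False
  then obtain v where v: "v \<in> S" by blast
  have "nb v \<subseteq> V - S" using assms v G_in2 by auto
  then have "card (nb v) \<le> card V - card S"
    using card_mono[of "V - S" "nb v"] assms(1) finite_V finite_subset
    by (metis card_Diff_subset finite_Diff)
  moreover have "card S \<le> card V" using assms(1) finite_V card_mono by blast
  ultimately show ?thesis using dense[of v] v assms(1) by auto
qed simp

lemma nb_inter:
  assumes "G z x"
  shows "5 * card (nb z) < 5 * card (nb z \<inter> nb x) + 2 * card V"
  using card_nb_Int[of z x] dense[of x] assms G_in G_sym by fastforce

text \<open>Distinct rim vertices need not be demanded: the neighbourhood of \<open>z\<close> is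
  triangle-free, and there every closed walk of length five is a 5-cycle.\<close>

definition wheel where
  "wheel z a b c d e \<longleftrightarrow> G z a \<and> G z b \<and> G z c \<and> G z d \<and> G z e \<and>
     G a b \<and> G b c \<and> G c d \<and> G d e \<and> G e a"

text \<open>The common neighbours of the rim form more than a fifth of all vertices. If neither \<open>p\<close> nor \<open>q\<close>
  saw any of them, the independent set of common neighbours of \<open>p\<close> and \<open>q\<close> would be larger than
  two fifths of all vertices.\<close>

lemma wheel_rim_nb:
  assumes w: "wheel z a b c d e" and "G p q" "G p a" "G p b"
  shows "\<exists>r. G r a \<and> G r b \<and> G r c \<and> G r d \<and> G r e \<and> G r q"
proof (rule ccontr)
  assume neg: "\<not> ?thesis"
  define R where "R = {u. G u a \<and> G u b \<and> G u c \<and> G u d \<and> G u e}"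
  have RV: "R \<subseteq> V" using G_in R_def by blast
  then have finR: "finite R" using finite_V finite_subset by blast
  have wh: "G z a" "G z b" "G z c" "G z d" "G z e" "G a b" "G b c" "G c d" "G d e" "G e a"
    using w unfolding wheel_def by auto
  have zV: "z \<in> V" "a \<in> V" "b \<in> V" "c \<in> V" "d \<in> V" "e \<in> V" "p \<in> V" "q \<in> V"
    using wh assms G_in G_sym by blast+
  \<comment> \<open>The hub gets weight 2 and each rim vertex weight 1. A neighbour of
    \<open>z\<close> sees no two consecutive rim vertices, hence at most two of five; any other
    vertex sees at most four unless it lies in \<open>R\<close>. The total weight 7 gives an average
    above 21/5, which leaves more than a fifth of all vertices for \<open>R\<close>.\<close>
  have cov: "length (filter (G u) [a,b,c,d,e]) + (if u \<in> nb z then 2 else 0)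
      \<le> 4 + (if u \<in> R then 1 else 0)" for u
  proof (cases "G z u")
    case True
    then have "\<not> (G u a \<and> G u b)" "\<not> (G u b \<and> G u c)" "\<not> (G u c \<and> G u d)" "\<not> (G u d \<and> G u e)"
      "\<not> (G u e \<and> G u a)"
      using no_K4[of z u a b] no_K4[of z u b c] no_K4[of z u c d] no_K4[of z u d e] no_K4[of z u e a] wh
      by blast+
    then show ?thesis using True by auto
  next
    case False
    then show ?thesis unfolding R_def by auto
  qed
  have "(\<Sum>u\<in>V. length (filter (G u) [a,b,c,d,e]) + (if u \<in> nb z then 2 else 0))
      \<le> (\<Sum>u\<in>V. 4 + (if u \<in> R then 1 else 0))"
    by (rule sum_mono) (rule cov)
  moreover have "(\<Sum>u\<in>V. if u \<in> nb z then (2::nat) else 0) = 2 * card (nb z)"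
    using nb_subset[of z] finite_V by (simp add: sum.If_cases Int_absorb1 nb_def)
  moreover have "(\<Sum>u\<in>V. if u \<in> R then (1::nat) else 0) = card R"
    using RV finite_V by (simp add: sum.If_cases Int_absorb1)
  ultimately have "(\<Sum>x\<leftarrow>[a,b,c,d,e]. card (nb x)) + 2 * card (nb z) \<le> 4 * card V + card R"
    unfolding sum.distrib sum_hits by simp
  then have R_big: "card V < 5 * card R"
    using dense[of a] dense[of b] dense[of c] dense[of d] dense[of e] dense[of z] zV by simp
  have pR: "\<not> G p r" if "r \<in> R" for r
    using that no_K4[of p r a b] assms wh unfolding R_def by blast
  have qR: "\<not> G q r" if "r \<in> R" for r using that neg G_sym unfolding R_def by blast
  have "nb p \<union> nb q \<subseteq> V - R" using pR qR G_in2 by auto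
  then have "card (nb p \<union> nb q) \<le> card V - card R"
    using card_mono[of "V - R" "nb p \<union> nb q"] finite_V RV finR card_Diff_subset by (metis finite_Diff)
  moreover have "card R \<le> card V" using RV finite_V card_mono by blast
  moreover have "5 * card (nb p \<inter> nb q) \<le> 2 * card V"
  proof (rule independent_card)
    show "nb p \<inter> nb q \<subseteq> V" using nb_subset by blast
    show "\<not> G u v" if "u \<in> nb p \<inter> nb q" "v \<in> nb p \<inter> nb q" for u v
      using that no_K4[of p q u v] \<open>G p q\<close> by auto
  qed
  moreover have "card (nb p) + card (nb q) = card (nb p \<union> nb q) + card (nb p \<inter> nb q)"
    by (rule card_Un_Int) simp_all
  ultimately show False using R_big dense[of p] dense[of q] zV by linarith
qed

text \<open>Counting \<open>z\<close> and \<open>t\<close> twice, no vertex sees more than 6 out of a total weight of 10.\<close>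

lemma no_double_link:
  assumes "G z t" "G z a" "G t a" "G z y" "G t y"
    and "G z c" "G z s" "G a c" "G c s" "G s y"
    and "G t r" "G t q" "G a r" "G r q" "G q y"
  shows False
proof -
  have V: "set [z,z,t,t,a,y,c,s,r,q] \<subseteq> V" using assms G_in G_in2 by auto
  obtain u where u: "u \<in> V"
    "3 * length [z,z,t,t,a,y,c,s,r,q] < 5 * length (filter (G u) [z,z,t,t,a,y,c,s,r,q])"
    using dense_pigeonhole[of "[z,z,t,t,a,y,c,s,r,q]"] V by auto
  have 1: "\<not> (G u z \<and> G u t \<and> G u a)" "\<not> (G u z \<and> G u t \<and> G u y)"
    "\<not> (G u z \<and> G u a \<and> G u c)" "\<not> (G u z \<and> G u c \<and> G u s)" "\<not> (G u z \<and> G u s \<and> G u y)"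
    "\<not> (G u t \<and> G u a \<and> G u r)" "\<not> (G u t \<and> G u r \<and> G u q)" "\<not> (G u t \<and> G u q \<and> G u y)"
    using no_K4 assms by blast+
  then show False using u(2)
    by (cases "G u z"; cases "G u t") (auto split: if_splits)
qed

text \<open>If no 5-cycle in the neighbourhood of \<open>z\<close> used the edge \<open>t y\<close>, this neighbourhood would split into
  two independent sets \<open>L\<close> and \<open>K\<close>, which the rim, an odd cycle, excludes.\<close>

lemma five_cycle_through_edge:
  assumes w: "wheel z a b c d e" and zt: "G z t" and zy: "G z y" and ty: "G t y"
  shows "\<exists>p q r. wheel z t y p q r"
proof (rule ccontr)
  assume neg: "\<not> ?thesis"
  define N where "N x = nb z \<inter> nb x" for x
  have N_sub: "N x \<subseteq> nb z" and finN [simp]: "finite (N x)" for x unfolding N_def by auto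
  have big: "5 * card (nb z) < 5 * card (N x) + 2 * card V" if "G z x" for x
    using nb_inter[OF that] N_def by simp
  have zbig: "3 * card V < 5 * card (nb z)" using dense G_in zt by blast
  \<comment> \<open>Each \<open>N x\<close> lacks fewer than 2/5 of all vertices from
    \<open>nb z\<close>, which contains more than 3/5. Three disjoint sets of this kind would have
    total size above \<open>card (nb z)\<close>.\<close>
  have no_three: False
    if "G z x1" "G z x2" "G z x3" "N x1 \<inter> N x2 = {}" "N x1 \<inter> N x3 = {}" "N x2 \<inter> N x3 = {}"
    for x1 x2 x3
  proof -
    have "card (N x1 \<union> N x2 \<union> N x3) = card (N x1) + card (N x2) + card (N x3)"
      using that by (simp add: card_Un_disjoint Int_Un_distrib2)
    moreover have "card (N x1 \<union> N x2 \<union> N x3) \<le> card (nb z)"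
      using N_sub by (intro card_mono) auto
    ultimately show False using big[OF that(1)] big[OF that(2)] big[OF that(3)] zbig by linarith
  qed
  have edge_disj: "N x \<inter> N y' = {}" if "G z x" "G z y'" "G x y'" for x y'
    unfolding N_def using no_K4[OF that(1,2) _ that(3)] by auto
  define L where "L = {l. G z l \<and> N l \<inter> N y \<noteq> {}}"
  define K where "K = {l. G z l \<and> N l \<inter> N t \<noteq> {}}"
  have disj: "l \<notin> K" if lL: "l \<in> L" for l
  proof
    assume "l \<in> K"
    then obtain v where "G z v" "G l v" "G t v" "G z l" unfolding K_def N_def by auto
    moreover obtain u where "G z u" "G l u" "G y u" using lL unfolding L_def N_def by auto
    ultimately have "wheel z t y u l v" unfolding wheel_def using zt zy ty G_sym by blast
    then show False using neg by blast
  qed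
  have cover: "l \<in> L \<or> l \<in> K" if "G z l" for l
    using no_three[OF that zt zy] edge_disj[OF zt zy ty] that unfolding L_def K_def by auto
  have L: "G z l \<and> N l \<inter> N t = {}" if "l \<in> L" for l
    using that disj[OF that] unfolding L_def K_def by blast
  have K: "G z l \<and> N l \<inter> N y = {}" if "l \<in> K" for l
    using that disj[of l] unfolding L_def K_def by blast
  have L_indep: "\<not> G l l'" if "l \<in> L" "l' \<in> L" for l l'
  proof
    assume "G l l'"
    with L[OF that(1)] L[OF that(2)] edge_disj[of l l'] show False
      by (intro no_three[of l l' t]) (simp_all add: zt)
  qed
  have K_indep: "\<not> G l l'" if "l \<in> K" "l' \<in> K" for l l'
  proof
    assume "G l l'"
    with K[OF that(1)] K[OF that(2)] edge_disj[of l l'] show False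
      by (intro no_three[of l l' y]) (simp_all add: zy)
  qed
  have rim: "G z a \<and> G z b \<and> G z c \<and> G z d \<and> G z e \<and> G a b \<and> G b c \<and> G c d \<and> G d e \<and> G e a"
    using w unfolding wheel_def .
  show False
    using cover[of a] cover[of b] cover[of c] cover[of d] cover[of e] rim L_indep K_indep by blast
qed

end

section \<open>Edge-maximal graphs: a vertex that sees an end of every edge\<close>

locale maximal_dense_K4_free_graph = dense_K4_free_graph +
  assumes maximal: "u \<in> V \<Longrightarrow> v \<in> V \<Longrightarrow> u \<noteq> v \<Longrightarrow> \<not> G u v \<Longrightarrow>
    \<exists>x y. G x y \<and> G u x \<and> G u y \<and> G v x \<and> G v y"
begin

text \<open>By maximality \<open>z\<close> forms a diamond with each of \<open>p\<close> and \<open>q\<close>. Together with the edge \<open>p q\<close> this is a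
  Moser spindle, and some vertex sees five of its seven vertices.\<close>

lemma spindle_wheel:
  assumes z: "z \<in> V" and pq: "G p q" "\<not> G z p" "\<not> G z q"
  shows "\<exists>t y y'. wheel t z y p q y'"
proof -
  have V: "p \<in> V" "q \<in> V" using pq G_in G_in2 by auto
  have ne: "z \<noteq> p" "z \<noteq> q" using pq G_sym by blast+
  obtain a b where ab: "G a b" "G z a" "G z b" "G p a" "G p b"
    using maximal[OF z V(1) ne(1) pq(2)] by blast
  obtain c d where cd: "G c d" "G z c" "G z d" "G q c" "G q d"
    using maximal[OF z V(2) ne(2) pq(3)] by blast
  have "set [z,p,q,a,b,c,d] \<subseteq> V" using ab cd V G_in G_in2 by auto
  then obtain t where t: "3 * length [z,p,q,a,b,c,d] < 5 * length (filter (G t) [z,p,q,a,b,c,d])"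
    using dense_pigeonhole[of "[z,p,q,a,b,c,d]"] by auto
  have no: "\<not> (G t a \<and> G t b \<and> G t z)" "\<not> (G t a \<and> G t b \<and> G t p)"
    "\<not> (G t c \<and> G t d \<and> G t z)" "\<not> (G t c \<and> G t d \<and> G t q)"
    using no_K4[of z t a b] no_K4[of p t a b] no_K4[of z t c d] no_K4[of q t c d] ab cd G_sym by blast+
  \<comment> \<open>At least five of the seven are seen. Seeing both \<open>a\<close> and
    \<open>b\<close> excludes \<open>z\<close> and \<open>p\<close> and leaves at most two of
    \<open>q\<close>, \<open>c\<close>, \<open>d\<close>, so at most four in all; likewise for
    \<open>c\<close> and \<open>d\<close>. Hence one of each pair is seen, together with
    \<open>z\<close>, \<open>p\<close> and \<open>q\<close>.\<close>
  have hit: "G t z \<and> G t p \<and> G t q \<and> (G t a \<or> G t b) \<and> (G t c \<or> G t d)"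
    using t no by (auto split: if_splits)
  obtain y where "G t y" "G z y" "G p y" using hit ab by blast
  moreover obtain y' where "G t y'" "G z y'" "G q y'" using hit cd by blast
  ultimately show ?thesis using hit pq G_sym unfolding wheel_def by blast
qed

text \<open>Two interlocked wheels: one with hub \<open>t\<close> and \<open>z\<close> on its rim,
  the other with hub \<open>z\<close> and \<open>t\<close> on its rim, both having \<open>y\<close>
  next to the other hub. Each rim contains an edge, \<open>p q\<close> or \<open>b c\<close>, whose
  first end sees two consecutive rim vertices of the other wheel, so \<open>wheel_rim_nb\<close>
  applies in both directions. The vertices \<open>r\<close> and \<open>s\<close> obtained complete
  the configuration excluded by \<open>no_double_link\<close>.\<close>

lemma hub_sees_every_edge:
  assumes w: "wheel z a0 b0 c0 d0 e0" and pq: "G p q" "\<not> G z p" "\<not> G z q"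
  shows False
proof -
  have zV: "z \<in> V" using w G_in unfolding wheel_def by blast
  obtain t y y' where w': "wheel t z y p q y'" using spindle_wheel[OF zV pq] by blast
  then have e': "G t z" "G t y" "G t p" "G t q" "G t y'" "G z y" "G y p" "G p q" "G q y'" "G y' z"
    unfolding wheel_def by auto
  obtain b c a where w2: "wheel z t y b c a"
    using five_cycle_through_edge[OF w, of t y] e' G_sym by blast
  then have e2: "G z t" "G z y" "G z b" "G z c" "G z a" "G t y" "G y b" "G b c" "G c a" "G a t"
    unfolding wheel_def by auto
  obtain r where r: "G r t" "G r a" "G r q"
    using wheel_rim_nb[OF w2 \<open>G p q\<close>] e' G_sym by blast
  obtain s where s: "G s z" "G s y'" "G s c"
    using wheel_rim_nb[OF w' \<open>G b c\<close>] e2 G_sym by blast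
  show False
    by (rule no_double_link[of z t a y' c s r q]) (use e' e2 r s G_sym in blast)+
qed

text \<open>A vertex that misses an edge produces, through the spindle, the hub of a 5-wheel, and a
  hub misses no edge.\<close>

lemma ex_independent_nonneighbourhood:
  assumes "V \<noteq> {}"
  shows "\<exists>v\<in>V. \<forall>p q. G p q \<longrightarrow> G v p \<or> G v q"
proof (rule ccontr)
  assume neg: "\<not> ?thesis"
  obtain z where "z \<in> V" using assms by blast
  with neg obtain p q where "G p q" "\<not> G z p" "\<not> G z q" by blast
  with \<open>z \<in> V\<close> obtain t y y' where w: "wheel t z y p q y'" using spindle_wheel by blast
  moreover have "t \<in> V" using w G_in unfolding wheel_def by blast
  ultimately show False using neg hub_sees_every_edge by blast
qed

end

text \<open>Adding edges only raises degrees, so one may pass to an edge-maximal supergraph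
  \<open>H\<close> without K4. Let \<open>v\<close> see an end of every edge of \<open>H\<close>.
  Its non-neighbours form the independent set, and a triangle avoiding them would lie in the
  neighbourhood of \<open>v\<close> and give a K4.\<close>

lemma (in dense_K4_free_graph) independent_triangle_free_split:
  "\<exists>I\<subseteq>V. (\<forall>u\<in>I. \<forall>v\<in>I. \<not> G u v) \<and>
     (\<forall>a b c. a \<notin> I \<longrightarrow> b \<notin> I \<longrightarrow> c \<notin> I \<longrightarrow> G a b \<longrightarrow> G a c \<longrightarrow> G b c \<longrightarrow> False)"
proof (cases "V = {}")
  case True
  then show ?thesis using G_in by blast
next
  case False
  define \<E> where "\<E> = {E. E \<subseteq> V \<times> V \<and> {(u, v). G u v} \<subseteq> E \<and> K4_free_graph V (\<lambda>u v. (u, v) \<in> E)}"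
  have "finite \<E>"
    by (rule finite_subset[of _ "Pow (V \<times> V)"]) (auto simp: \<E>_def finite_V)
  moreover have "{(u, v). G u v} \<in> \<E>"
    unfolding \<E>_def using K4_free_graph_axioms G_in G_in2 by auto
  ultimately obtain E where E: "E \<in> \<E>" and max: "\<And>F. F \<in> \<E> \<Longrightarrow> E \<subseteq> F \<Longrightarrow> E = F"
    using finite_has_maximal2[of \<E>] by (metis (no_types, lifting))
  define H where "H u v \<longleftrightarrow> (u, v) \<in> E" for u v
  have HG: "H u v" if "G u v" for u v using E that unfolding \<E>_def H_def by auto
  interpret H: K4_free_graph V H using E unfolding \<E>_def H_def by simp
  interpret H: dense_K4_free_graph V H
  proof
    fix v assume "v \<in> V"
    moreover have "card (nb v) \<le> card (H.nb v)" by (rule card_mono) (auto intro: HG)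
    ultimately show "3 * card V < 5 * card (H.nb v)" using dense[of v] by simp
  qed
  interpret H: maximal_dense_K4_free_graph V H
  proof
    fix u v assume uv: "u \<in> V" "v \<in> V" "u \<noteq> v" "\<not> H u v"
    define F where "F x y \<longleftrightarrow> H x y \<or> (x = u \<and> y = v) \<or> (x = v \<and> y = u)" for x y
    have F_sym: "F x y \<Longrightarrow> F y x" for x y
      unfolding F_def using H.G_sym[of x y] by blast
    have F_irrefl: "\<not> F x x" for x
      unfolding F_def using H.G_irrefl uv(3) by blast
    have F_cases: "H x y" if "F x y" "{x, y} \<noteq> {u, v}" for x y
      using that unfolding F_def by blast
    \<comment> \<open>A K4 created by the new edge must use it as \<open>a b\<close>; the other two
      vertices are then adjacent common neighbours of \<open>u\<close> and \<open>v\<close> in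
      \<open>H\<close> itself.\<close>
    have step: "\<exists>x y. H x y \<and> H u x \<and> H u y \<and> H v x \<and> H v y"
      if "F a b" "\<not> H a b" "F a c" "F a d" "F b c" "F b d" "F c d" for a b c d
    proof -
      have ab: "a = u \<and> b = v \<or> a = v \<and> b = u" using that(1,2) unfolding F_def by blast
      have "c \<noteq> a" "c \<noteq> b" "d \<noteq> a" "d \<noteq> b" using that F_irrefl by blast+
      with ab have "H a c" "H a d" "H b c" "H b d" "H c d"
        using that by (auto intro!: F_cases simp: doubleton_eq_iff)
      with ab show ?thesis by blast
    qed
    have "{(x, y). F x y} \<notin> \<E>"
    proof
      assume "{(x, y). F x y} \<in> \<E>"
      moreover have "E \<subseteq> {(x, y). F x y}" unfolding F_def H_def by auto
      ultimately have "E = {(x, y). F x y}" by (rule max)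
      then show False using uv unfolding F_def H_def by blast
    qed
    moreover have "{(x, y). F x y} \<subseteq> V \<times> V" unfolding F_def using uv H.G_in H.G_in2 by auto
    moreover have "{(u, v). G u v} \<subseteq> {(x, y). F x y}" unfolding F_def using HG by auto
    ultimately have "\<not> K4_free_graph V F" unfolding \<E>_def by auto
    moreover have "fin_graph V F"
      proof
      show "u' \<in> V" if "F u' v'" for u' v' using that uv H.G_in unfolding F_def by blast
    qed (use finite_V F_sym F_irrefl in auto)
    ultimately obtain a b c d where
      *: "F a b" "F a c" "F a d" "F b c" "F b d" "F c d"
      unfolding K4_free_graph_def K4_free_graph_axioms_def by blast
    have "\<not> (H a b \<and> H a c \<and> H a d \<and> H b c \<and> H b d \<and> H c d)" using H.no_K4 by blast
    then consider "\<not> H a b" | "\<not> H a c" | "\<not> H a d" | "\<not> H b c" | "\<not> H b d" | "\<not> H c d" by blast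
    then show "\<exists>x y. H x y \<and> H u x \<and> H u y \<and> H v x \<and> H v y"
      using * F_sym step[of a b c d] step[of a c b d] step[of a d b c] step[of b c a d]
        step[of b d a c] step[of c d a b]
      by cases metis+
  qed
  obtain v where v: "v \<in> V" "\<And>p q. H p q \<Longrightarrow> H v p \<or> H v q"
    using H.ex_independent_nonneighbourhood[OF False] by blast
  show ?thesis
  proof (intro exI[of _ "V - H.nb v"] conjI ballI allI impI)
    show "\<not> G u w" if "u \<in> V - H.nb v" "w \<in> V - H.nb v" for u w
      using that v(2)[of u w] HG[of u w] by auto
    show False
      if "a \<notin> V - H.nb v" "b \<notin> V - H.nb v" "c \<notin> V - H.nb v" "G a b" "G a c" "G b c" for a b c
    proof -
      have "H v a" "H v b" "H v c" using that G_in[of a b] G_in[of b c] G_in2[of a c] by auto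
      then show False using H.no_K4[of v a b c] HG that by blast
    qed
  qed auto
qed

section \<open>Balanced multipartite graphs\<close>

text \<open>A form of the Andrasfai-Erdos-Sos theorem in which one vertex \<open>z\<close> may have
  a better degree bound than the others. The 5-cycles to be excluded all pass through
  \<open>z\<close>, so its degree enters the count once.\<close>

lemma (in fin_graph) bipartite_if_large_degrees:
  assumes U: "U \<subseteq> V"
    and triangle_free: "\<And>a b c. a \<in> U \<Longrightarrow> b \<in> U \<Longrightarrow> c \<in> U \<Longrightarrow> G a b \<Longrightarrow> G a c \<Longrightarrow> G b c \<Longrightarrow> False"
    and deg: "\<And>x. x \<in> U \<Longrightarrow> d \<le> card (nb x \<inter> U)"
    and z: "z \<in> U" "s \<le> card (nb z \<inter> U)" and large: "2 * card U < s + 4 * d"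
  shows "\<exists>X\<subseteq>U. (\<forall>u\<in>X. \<forall>v\<in>X. \<not> G u v) \<and> (\<forall>u\<in>U - X. \<forall>v\<in>U - X. \<not> G u v)"
proof -
  have finU: "finite U" using U finite_V finite_subset by blast
  define N where "N = nb z \<inter> U"
  define X where "X = {x \<in> U - N. \<exists>u\<in>N. G u x}"
  \<comment> \<open>In a triangle-free graph no vertex sees three vertices of a closed 5-walk, so
    the five degrees add up to at most \<open>2 * card U\<close>. Hence the second neighbourhood
    \<open>X\<close> of \<open>z\<close> is independent.\<close>
  have cycle: False
    if "u \<in> N" "v \<in> N" "x \<in> U" "y \<in> U" "G u x" "G v y" "G x y" for u v x y
  proof -
    have uv: "u \<in> U" "v \<in> U" "G z u" "G z v" using that unfolding N_def by auto
    have "length (filter (G w) [z, u, x, y, v]) \<le> 2" if "w \<in> U" for w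
    proof -
      have "\<not> (G w z \<and> G w u)" "\<not> (G w z \<and> G w v)" "\<not> (G w u \<and> G w x)" "\<not> (G w x \<and> G w y)"
        "\<not> (G w v \<and> G w y)"
        using triangle_free[OF that] z(1) uv \<open>x \<in> U\<close> \<open>y \<in> U\<close> \<open>G u x\<close> \<open>G v y\<close> \<open>G x y\<close> by blast+
      then show ?thesis by auto
    qed
    then have "(\<Sum>w\<in>U. length (filter (G w) [z, u, x, y, v])) \<le> card U * 2"
      using sum_bounded_above[of U "\<lambda>w. length (filter (G w) [z, u, x, y, v])" 2] by simp
    moreover have "(\<Sum>w\<in>U. length (filter (G w) xs)) = (\<Sum>x\<leftarrow>xs. card (nb x \<inter> U))" for xs
    proof (induction xs)
      case (Cons x xs)
      have "(\<Sum>w\<in>U. length (filter (G w) (x # xs))) =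
          (\<Sum>w\<in>U. (if w \<in> nb x \<inter> U then 1 else 0) + length (filter (G w) xs))"
        by (rule sum.cong) (auto dest: G_sym)
      also have "\<dots> = card (nb x \<inter> U) + (\<Sum>w\<in>U. length (filter (G w) xs))"
        using finU by (simp add: sum.distrib sum.If_cases nb_def Int_ac Collect_conj_eq)
      finally show ?case using Cons.IH by simp
    qed simp
    ultimately have "(\<Sum>x\<leftarrow>[z, u, x, y, v]. card (nb x \<inter> U)) \<le> card U * 2" by (simp only:)
    then show False using deg[of u] deg[of v] deg[of x] deg[of y] z large uv \<open>x \<in> U\<close> \<open>y \<in> U\<close>
      by simp
  qed
  have X_indep: "\<not> G x y" if "x \<in> X" "y \<in> X" for x y
    using that cycle unfolding X_def by blast
  have N_indep: "\<not> G x y" if "x \<in> N" "y \<in> N" for x y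
    using that triangle_free[of z x y] z(1) unfolding N_def by auto
  have rest_indep: "\<not> G x y" if "x \<in> U - N - X" "y \<in> U - N - X" for x y
  proof
    assume "G x y"
    have "(nb x \<inter> U) \<inter> (nb y \<inter> U) = {}" using triangle_free[of x y] that \<open>G x y\<close> by auto
    then have "card (nb x \<inter> U) + card (nb y \<inter> U) = card (nb x \<inter> U \<union> nb y \<inter> U)"
      by (simp add: card_Un_disjoint)
    also have "\<dots> \<le> card (U - N)"
      using that G_sym finU by (intro card_mono) (auto simp: X_def)
    also have "\<dots> = card U - card N" using finU by (simp add: N_def card_Diff_subset)
    finally have "card (nb x \<inter> U) + card (nb y \<inter> U) \<le> card U - card N" .
    moreover have "card N \<le> card U" using finU by (simp add: N_def card_mono)
    ultimately show False using deg[of x] deg[of y] that z(2) large N_def by auto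
  qed
  have out_indep: "\<not> G u v" if "u \<in> U - X" "v \<in> U - X" for u v
  proof
    assume uv: "G u v"
    consider "u \<in> N" "v \<in> N" | "u \<in> N" "v \<notin> N" | "u \<notin> N" "v \<in> N" | "u \<notin> N" "v \<notin> N" by blast
    then show False
    proof cases
      case 1
      then show False using N_indep uv by blast
    next
      case 2
      then show False using that uv unfolding X_def by blast
    next
      case 3
      then show False using that G_sym[OF uv] unfolding X_def by blast
    next
      case 4
      then show False using that rest_indep uv by blast
    qed
  qed
  show ?thesis
  proof (intro exI[of _ X] conjI ballI)
    show "X \<subseteq> U" unfolding X_def by blast
  qed (use X_indep out_indep in simp_all)
qed

section \<open>Degree conditions that an independent set imposes on the parts\<close>

locale balanced_K4_free = K4_free_graph +
  fixes P :: "'a set set" and n d :: nat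
  assumes partition: "partition_on V P"
    and part_card: "A \<in> P \<Longrightarrow> card A = n"
    and part_indep: "A \<in> P \<Longrightarrow> u \<in> A \<Longrightarrow> v \<in> A \<Longrightarrow> \<not> G u v"
    and min_deg: "v \<in> V \<Longrightarrow> d \<le> card (nb v)"
begin

lemma finite_P: "finite P"
  using partition finite_V finite_elements by blast

lemma part_subset: "A \<in> P \<Longrightarrow> A \<subseteq> V"
  using partition partition_onD1 by blast

lemma finite_part: "A \<in> P \<Longrightarrow> finite A"
  using part_subset finite_V finite_subset by blast

lemma obtain_part:
  assumes "v \<in> V" obtains A where "A \<in> P" "v \<in> A"
  using assms partition partition_onD1 by blast

lemma sum_parts:
  assumes "S \<subseteq> V" shows "card S = (\<Sum>A\<in>P. card (S \<inter> A))"
proof -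
  have "V = \<Union>P" using partition by (rule partition_onD1)
  then have "S = (\<Union>A\<in>P. S \<inter> A)" using assms by auto
  then have "card S = card (\<Union>A\<in>P. S \<inter> A)" by simp
  also have "\<dots> = (\<Sum>A\<in>P. card (S \<inter> A))"
    using finite_P finite_part partition_onD2[OF partition]
    by (intro card_UN_disjoint) (auto simp: disjoint_def)
  finally show ?thesis .
qed

lemma card_V: "card V = card P * n"
proof -
  have "card V = (\<Sum>A\<in>P. card (V \<inter> A))" by (rule sum_parts) simp
  also have "\<dots> = (\<Sum>A\<in>P. n)"
    by (rule sum.cong) (use part_subset part_card in \<open>auto simp: Int_absorb1\<close>)
  finally show ?thesis by simp
qed

text \<open>The vertex \<open>v\<close> has no neighbour in \<open>I \<union> A\<close>. This
  inequality is the source of all column conditions in the later optimisation.\<close>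

lemma independent_part_bound:
  assumes "I \<subseteq> V" and indep: "\<And>u v. u \<in> I \<Longrightarrow> v \<in> I \<Longrightarrow> \<not> G u v" and v: "v \<in> I" "v \<in> A" "A \<in> P"
  shows "d + card I + n \<le> card P * n + card (I \<inter> A)"
proof -
  have fin: "finite I" "finite A" using assms finite_V finite_subset finite_part by blast+
  have sub: "I \<union> A \<subseteq> V" using assms part_subset by blast
  have "nb v \<subseteq> V - (I \<union> A)"
    using indep[OF v(1)] part_indep[OF v(3,2)] nb_subset[of v] by (auto simp: nb_def)
  then have "card (nb v) \<le> card V - card (I \<union> A)"
    using card_mono[of "V - (I \<union> A)" "nb v"] finite_V fin sub by (simp add: card_Diff_subset)
  moreover have "card (I \<union> A) \<le> card V" using sub finite_V card_mono by blast
  moreover have "card (I \<union> A) + card (I \<inter> A) = card I + n"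
    using card_Un_Int[OF fin] part_card[OF v(3)] by simp
  moreover have "d \<le> card (nb v)" using min_deg v(1) assms(1) by blast
  ultimately show ?thesis using card_V by linarith
qed

text \<open>Inside \<open>I\<close> the vertex \<open>x\<close> can see at most the part of
  \<open>I\<close> outside \<open>A\<close>. So the more \<open>I\<close> contains of
  \<open>A\<close>, the more neighbours \<open>x\<close> must have outside \<open>I\<close>.\<close>

lemma outer_degree:
  assumes "I \<subseteq> V" and "x \<in> A" "A \<in> P"
  shows "d + card (I \<inter> A) \<le> card (nb x \<inter> (V - I)) + card I"
proof -
  have finI: "finite I" using assms finite_V finite_subset by blast
  have "card (nb x) = card (nb x \<inter> (V - I)) + card (nb x \<inter> I)"
  proof -
    have "nb x - I = nb x \<inter> (V - I)" using nb_subset by blast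
    then show ?thesis using card_Int_Diff[OF finite_nb, of x I] by simp
  qed
  moreover have "card (nb x \<inter> I) \<le> card (I - A)"
    using assms(2,3) part_indep[OF assms(3,2)] finI by (intro card_mono) auto
  moreover have "card (I - A) + card (I \<inter> A) = card I"
    using card_Int_Diff[OF finI, of A] by simp
  moreover have "d \<le> card (nb x)" using min_deg part_subset assms(2,3) by blast
  ultimately show ?thesis by linarith
qed

text \<open>Outside \<open>I\<close> the ends of an edge have no common neighbour, so their outer
  degrees add up to at most the size of the complement of \<open>I\<close>.\<close>

lemma outer_edge:
  assumes "I \<subseteq> V"
    and triangle_free: "\<forall>a b c. a \<notin> I \<longrightarrow> b \<notin> I \<longrightarrow> c \<notin> I \<longrightarrow> G a b \<longrightarrow> G a c \<longrightarrow> G b c \<longrightarrow> False"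
    and x: "x \<in> A" "A \<in> P" "x \<notin> I" and y: "y \<in> B" "B \<in> P" "y \<notin> I" and "G x y"
  shows "2 * d + card (I \<inter> A) + card (I \<inter> B) \<le> card P * n + card I"
proof -
  have "(nb x \<inter> (V - I)) \<inter> (nb y \<inter> (V - I)) = {}"
  proof (rule ccontr)
    assume "\<not> ?thesis"
    then obtain w where "w \<notin> I" "G x w" "G y w" by auto
    then show False using triangle_free x(3) y(3) \<open>G x y\<close> by blast
  qed
  then have "card (nb x \<inter> (V - I)) + card (nb y \<inter> (V - I)) = card (nb x \<inter> (V - I) \<union> nb y \<inter> (V - I))"
    by (simp add: card_Un_disjoint)
  also have "\<dots> \<le> card (V - I)" using finite_V by (intro card_mono) auto
  also have "\<dots> = card V - card I" using assms(1) finite_V finite_subset by (metis card_Diff_subset)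
  finally show ?thesis
    using outer_degree[OF assms(1) x(1,2)] outer_degree[OF assms(1) y(1,2)] card_V
      card_mono[OF finite_V assms(1)] by linarith
qed

lemma dense_if:
  assumes "3 * (card P * n) < 5 * d" shows "dense_K4_free_graph V G"
proof
  show "3 * card V < 5 * card (nb v)" if "v \<in> V" for v
    using min_deg[OF that] assms card_V by linarith
qed

lemma card_union_of_parts:
  assumes "I \<subseteq> V" and "\<And>A. A \<in> P \<Longrightarrow> I \<inter> A = {} \<or> A \<subseteq> I"
  shows "card I = card {A \<in> P. A \<subseteq> I \<and> A \<noteq> {}} * n"
proof -
  have "card I = (\<Sum>A\<in>P. card (I \<inter> A))" by (rule sum_parts) fact
  also have "\<dots> = (\<Sum>A\<in>P. if A \<subseteq> I \<and> A \<noteq> {} then n else 0)"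
  proof (rule sum.cong)
    fix A assume "A \<in> P"
    then consider "I \<inter> A = {}" | "A \<subseteq> I" using assms(2) by blast
    then show "card (I \<inter> A) = (if A \<subseteq> I \<and> A \<noteq> {} then n else 0)"
      using part_card[OF \<open>A \<in> P\<close>]
      by cases (auto simp: Int_absorb1 Int_absorb2)
  qed simp
  also have "\<dots> = card {A \<in> P. A \<subseteq> I \<and> A \<noteq> {}} * n"
    using finite_P by (simp add: sum.If_cases Int_def)
  finally show ?thesis .
qed

theorem degree_bound_mod_2:
  assumes r: "card P = 3 * k - 1" and k: "k \<ge> 2" and n: "n \<ge> 1"
  shows "d \<le> (2 * k - 1) * n"
proof (rule ccontr)
  assume "\<not> ?thesis"
  then have d: "d \<ge> (2 * k - 1) * n + 1" by simp
  obtain k' where k': "k = k' + 2" using k by (metis add.commute le_Suc_ex)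
  have rn: "card P * n = 3 * (k' * n) + 5 * n" and d': "d \<ge> 2 * (k' * n) + 3 * n + 1"
    using r d unfolding k' by (simp_all add: algebra_simps)
  interpret dense_K4_free_graph V G by (rule dense_if) (use rn d' in linarith)
  obtain I where I: "I \<subseteq> V" and indep: "\<And>u v. u \<in> I \<Longrightarrow> v \<in> I \<Longrightarrow> \<not> G u v"
    and tf: "\<forall>a b c. a \<notin> I \<longrightarrow> b \<notin> I \<longrightarrow> c \<notin> I \<longrightarrow> G a b \<longrightarrow> G a c \<longrightarrow> G b c \<longrightarrow> False"
    using independent_triangle_free_split by blast
  have small: "5 * card I \<le> 2 * (card P * n)" using independent_card[OF I] indep card_V by simp
  have edge: "\<exists>y B. G x y \<and> y \<notin> I \<and> B \<in> P \<and> y \<in> B" if "x \<in> A" "A \<in> P" "x \<notin> I" for x A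
  proof -
    have "card (nb x \<inter> (V - I)) \<noteq> 0" using outer_degree[OF I that(1,2)] small rn d' by linarith
    then obtain y where "y \<in> nb x \<inter> (V - I)" by (metis card.empty ex_in_conv)
    moreover then obtain B where "B \<in> P" "y \<in> B" using obtain_part[of y] by blast
    ultimately show ?thesis by auto
  qed
  \<comment> \<open>For a part met but not contained in \<open>I\<close>, the bounds
    \<open>independent_part_bound\<close> and \<open>outer_edge\<close> add up;
    \<open>card I\<close> and \<open>card (I \<inter> A)\<close> cancel, leaving
    \<open>3 * d + n \<le> 2 * card P * n\<close>, which the assumed degree violates. So
    \<open>I\<close> consists of \<open>p\<close> whole parts, and the same two bounds then force
    both p > k - 1 and p < k.\<close>
  have whole: "I \<inter> A = {} \<or> A \<subseteq> I" if A: "A \<in> P" for A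
  proof (rule ccontr)
    assume "\<not> ?thesis"
    then obtain v x where v: "v \<in> I" "v \<in> A" and x: "x \<in> A" "x \<notin> I" by blast
    obtain y B where "G x y" "y \<notin> I" "B \<in> P" "y \<in> B" using edge[OF x(1) A x(2)] by blast
    then have "2 * d + card (I \<inter> A) + card (I \<inter> B) \<le> card P * n + card I"
      using outer_edge[OF I tf x(1) A x(2)] by blast
    then show False using independent_part_bound[OF I indep v A] rn d' by linarith
  qed
  define p where "p = card {A \<in> P. A \<subseteq> I \<and> A \<noteq> {}}"
  have pI: "card I = p * n" using card_union_of_parts[OF I whole] p_def by simp
  have "I \<noteq> V" using small card_V rn n by auto
  then obtain x A where x: "x \<in> A" "A \<in> P" "x \<notin> I" using I obtain_part by blast
  then obtain y B where "G x y" "y \<notin> I" "B \<in> P" "y \<in> B" using edge by blast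
  then have "2 * d \<le> card P * n + p * n" using outer_edge[OF I tf x] pI by fastforce
  then have "k' * n + n < p * n" using rn d' by linarith
  then have p: "k' + 1 < p" by (metis add_mult_distrib mult_1 mult_less_cancel2)
  then have "{A \<in> P. A \<subseteq> I \<and> A \<noteq> {}} \<noteq> {}" unfolding p_def by (metis card.empty not_less0)
  then obtain A v where A: "A \<in> P" "A \<subseteq> I" "v \<in> A" by blast
  then have "d + p * n + n \<le> card P * n + n"
    using independent_part_bound[OF I indep, of v A] pI part_card by (auto simp: Int_absorb1)
  then have "p * n < k' * n + 2 * n" using rn d' by linarith
  then have "p < k' + 2" by (metis add_mult_distrib mult_less_cancel2)
  with p show False by simp
qed

text \<open>The complement of the independent set \<open>I\<close> is triangle-free, and what must
  be shown is that it is bipartite. If \<open>I\<close> is a union of parts, it has at most m - 1 of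
  them and the plain degree bound is enough. Otherwise some part is split by \<open>I\<close>, and a
  vertex of it outside \<open>I\<close> serves as the vertex with the better bound.\<close>

theorem three_colouring_mod_1:
  assumes r: "card P = 3 * m - 2" and m: "m \<ge> 3" and n: "n \<ge> 1" and e: "n < 4 * e"
    and d: "d \<ge> (2 * m - 2) * n + e"
  shows "\<exists>I X Y. I \<union> X \<union> Y = V \<and> I \<inter> X = {} \<and> I \<inter> Y = {} \<and> X \<inter> Y = {} \<and>
    (\<forall>u\<in>I. \<forall>v\<in>I. \<not> G u v) \<and> (\<forall>u\<in>X. \<forall>v\<in>X. \<not> G u v) \<and> (\<forall>u\<in>Y. \<forall>v\<in>Y. \<not> G u v)"
proof -
  obtain m' where m': "m = m' + 3" using m by (metis add.commute le_Suc_ex)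
  have rn: "card P * n = 3 * (m' * n) + 7 * n" and d': "d \<ge> 2 * (m' * n) + 4 * n + e"
    using r d unfolding m' by (simp_all add: algebra_simps)
  interpret dense_K4_free_graph V G by (rule dense_if) (use rn d' e in linarith)
  obtain I where I: "I \<subseteq> V" and indep: "\<And>u v. u \<in> I \<Longrightarrow> v \<in> I \<Longrightarrow> \<not> G u v"
    and tf: "\<forall>a b c. a \<notin> I \<longrightarrow> b \<notin> I \<longrightarrow> c \<notin> I \<longrightarrow> G a b \<longrightarrow> G a c \<longrightarrow> G b c \<longrightarrow> False"
    using independent_triangle_free_split by blast
  have small: "5 * card I \<le> 2 * (card P * n)" using independent_card[OF I] indep card_V by simp
  have cardU: "card (V - I) + card I = card P * n"
    using card_Int_Diff[OF finite_V, of I] I card_V by (simp add: Int_absorb1)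
  have deg: "d - card I \<le> card (nb x \<inter> (V - I))" if x: "x \<in> V - I" for x
  proof -
    obtain A where "A \<in> P" "x \<in> A" using x obtain_part[of x] by blast
    then show ?thesis using outer_degree[OF I, of x A] by linarith
  qed
  have "\<exists>z s. z \<in> V - I \<and> s \<le> card (nb z \<inter> (V - I)) \<and> 2 * card (V - I) < s + 4 * (d - card I)"
  proof (cases "\<forall>A\<in>P. I \<inter> A = {} \<or> A \<subseteq> I")
    case True
    define p where "p = card {A \<in> P. A \<subseteq> I \<and> A \<noteq> {}}"
    have pI: "card I = p * n" using card_union_of_parts[OF I] True p_def by simp
    have "p * n \<le> m' * n + 2 * n"
    proof (cases "{A \<in> P. A \<subseteq> I \<and> A \<noteq> {}} = {}")
      case True
      then have "p = 0" unfolding p_def by (metis card.empty)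
      then show ?thesis by simp
    next
      case False
      then obtain A v where A: "A \<in> P" "A \<subseteq> I" "v \<in> A" by blast
      then have "d + p * n + n \<le> card P * n + n"
        using independent_part_bound[OF I indep, of v A] pI part_card by (auto simp: Int_absorb1)
      then have "p * n < m' * n + 3 * n" using rn d' e by linarith
      then have "p < m' + 3" by (metis add_mult_distrib mult_less_cancel2)
      then have "p \<le> m' + 2" by simp
      then show ?thesis by (metis add_mult_distrib mult_le_mono1)
    qed
    moreover have "V - I \<noteq> {}" using small card_V rn n I by auto
    then obtain z where "z \<in> V - I" by blast
    ultimately show ?thesis
      using deg[of z] cardU pI rn d' e by (intro exI[of _ z] exI[of _ "d - card I"]) auto
  next
    case False
    then obtain A v z where A: "A \<in> P" "v \<in> I" "v \<in> A" "z \<in> A" "z \<notin> I" by blast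
    \<comment> \<open>The surplus \<open>card (I \<inter> A)\<close> in the degree of
      \<open>z\<close> cancels part of the same term in the bound on \<open>card I\<close>; with it
      the requirement becomes 2n < (m - 3) n + 8e, which is where \<open>n < 4 * e\<close> is
      used.\<close>
    have "card (I \<inter> A) \<le> n" using part_card[OF A(1)] finite_part[OF A(1)] card_mono by (metis Int_lower2)
    then show ?thesis
      using outer_degree[OF I A(4,1)] independent_part_bound[OF I indep A(2,3,1)] A part_subset[OF A(1)]
        cardU rn d' e
      by (intro exI[of _ z] exI[of _ "d + card (I \<inter> A) - card I"]) auto
  qed
  then obtain z s where z: "z \<in> V - I" "s \<le> card (nb z \<inter> (V - I))" "2 * card (V - I) < s + 4 * (d - card I)"
    by blast
  obtain X where "X \<subseteq> V - I" "\<forall>u\<in>X. \<forall>v\<in>X. \<not> G u v" "\<forall>u\<in>V - I - X. \<forall>v\<in>V - I - X. \<not> G u v"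
    using bipartite_if_large_degrees[OF _ _ deg z] tf by (metis DiffD2 Diff_subset)
  then show ?thesis using I indep
    by (intro exI[of _ I] exI[of _ X] exI[of _ "V - I - X"]) auto
qed

theorem degree_bound_mod_0:
  assumes "n \<ge> 1" "card P \<ge> 1"
  shows "3 * d \<le> 2 * (card P * n)"
proof (rule ccontr)
  assume "\<not> ?thesis"
  then have big: "2 * card V < 3 * card (nb v)" if "v \<in> V" for v
    using min_deg[OF that] card_V by linarith
  have "V \<noteq> {}" using card_V assms by auto
  then obtain u where u: "u \<in> V" by blast
  obtain v where v: "v \<in> V" "0 < length (filter (G v) [u])"
    using pigeonhole[of 0 "[u]"] big[OF u] by auto
  obtain w where w: "w \<in> V" "1 < length (filter (G w) [u, v])"
    using pigeonhole[of 1 "[u, v]"] big[OF u] big[OF v(1)] by auto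
  obtain x where x: "x \<in> V" "2 < length (filter (G x) [u, v, w])"
    using pigeonhole[of 2 "[u, v, w]"] big[OF u] big[OF v(1)] big[OF w(1)] by auto
  show False
    using no_K4[of x u v w] v w x G_sym by (auto split: if_splits)
qed

end

section \<open>Colour classes against parts\<close>

text \<open>Below \<open>P\<close> indexes the \<open>3 * M + 1\<close> parts, that is \<open>M = m - 1\<close>, the functions \<open>x\<close>, \<open>y\<close>, \<open>w\<close> give the sizes of
  three colour classes in the parts, and \<open>e\<close> is the excess of the minimum degree over \<open>2 * M * n\<close>.\<close>

lemma large_column_support:
  fixes x w :: "'p \<Rightarrow> nat" and M n e :: nat
  assumes fin: "finite P" and n: "n \<ge> 1" and e: "M * n < (3 * M + 4) * e"
    and row: "\<And>A. A \<in> P \<Longrightarrow> x A > 0 \<Longrightarrow> x A + w A = n"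
    and col: "\<And>A. A \<in> P \<Longrightarrow> x A > 0 \<Longrightarrow> sum x P + e \<le> M * n + x A"
    and large: "M * n + 2 * e \<le> sum x P"
  shows "card {A \<in> P. x A > 0} = M + 1"
    and "sum x P + sum w {A \<in> P. x A > 0} = (M + 1) * n"
    and "\<exists>A\<in>P. x A > 0 \<and> (\<forall>B\<in>P. x B > 0 \<longrightarrow> w B \<le> w A) \<and>
      e + w A \<le> sum w {A \<in> P. x A > 0} \<and> e \<le> M * w A"
proof -
  define S where "S = {A \<in> P. x A > 0}"
  have finS: "finite S" using fin unfolding S_def by simp
  have xS: "sum x P = sum x S" unfolding S_def
    by (rule sum.mono_neutral_right) (use fin in auto)
  have "sum x S + sum w S = (\<Sum>A\<in>S. n)"
    unfolding sum.distrib[symmetric] by (rule sum.cong) (use row in \<open>auto simp: S_def\<close>)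
  then have total: "sum x P + sum w S = card S * n" using xS by simp
  have pos: "e > 0" using e by (cases e) auto
  have lower: "M + 1 \<le> card S"
  proof (rule ccontr)
    assume "\<not> ?thesis"
    then have "card S * n \<le> M * n" by simp
    then show False using total large pos by linarith
  qed
  \<comment> \<open>The column condition is summed over a support of \<open>M + 2 + t\<close> rows
    and combined with the lower bound on the column sum. The excess is then counted 2 (M + 1 + t) +
    (M + 2 + t) times, which for t = 0 is the constant \<open>3 * M + 4\<close> of the
    hypothesis.\<close>
  have upper: "card S \<le> M + 1"
  proof (rule ccontr)
    assume "\<not> ?thesis"
    then obtain t where t: "card S = M + 2 + t" by (metis add_Suc_right less_natE not_le add.commute add_2_eq_Suc' Suc_eq_plus1)
    have "(\<Sum>A\<in>S. sum x P + e) \<le> (\<Sum>A\<in>S. M * n + x A)"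
      by (rule sum_mono) (use col in \<open>auto simp: S_def\<close>)
    then have "card S * (sum x P + e) \<le> card S * (M * n) + sum x P"
      by (simp add: sum.distrib xS)
    then have 1: "(M + 1 + t) * sum x P + (M + 2 + t) * e \<le> (M + 2 + t) * (M * n)"
      unfolding t by (simp add: algebra_simps)
    have "(M + 1 + t) * (M * n + 2 * e) \<le> (M + 1 + t) * sum x P" using large by (rule mult_le_mono2)
    with 1 have "(M + 1 + t) * (M * n + 2 * e) + (M + 2 + t) * e \<le> (M + 2 + t) * (M * n)" by linarith
    then have "(3 * M + 4) * e + 3 * t * e \<le> M * n" by (simp add: algebra_simps)
    then show False using e by linarith
  qed
  show card_S: "card {A \<in> P. x A > 0} = M + 1" using lower upper unfolding S_def by simp
  show sum_eq: "sum x P + sum w {A \<in> P. x A > 0} = (M + 1) * n"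
    using total card_S unfolding S_def by simp
  have "S \<noteq> {}" using lower by auto
  then have "Max (w ` S) \<in> w ` S" using finS by (intro Max_in) auto
  then obtain A where "A \<in> S" "w A = Max (w ` S)" by auto
  then have A: "A \<in> S" "\<And>B. B \<in> S \<Longrightarrow> w B \<le> w A" using finS by simp_all
  have AP: "A \<in> P" "x A > 0" using A(1) unfolding S_def by auto
  \<comment> \<open>This is the column condition for \<open>x\<close> at \<open>A\<close> rewritten
    for the complementary entries. As \<open>w A\<close> is the largest of \<open>M + 1\<close>
    entries, \<open>e \<le> M * w A\<close> follows.\<close>
  have 1: "e + w A \<le> sum w S"
    using col[OF AP] row[OF AP] sum_eq unfolding S_def by (simp add: algebra_simps)
  have "sum w S \<le> card S * w A" using A(2) sum_bounded_above[of S w "w A"] by simp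
  then have "e \<le> M * w A" using 1 card_S unfolding S_def by (simp add: algebra_simps)
  then show "\<exists>A\<in>P. x A > 0 \<and> (\<forall>B\<in>P. x B > 0 \<longrightarrow> w B \<le> w A) \<and>
      e + w A \<le> sum w {A \<in> P. x A > 0} \<and> e \<le> M * w A"
    using 1 A AP unfolding S_def by auto
qed

text \<open>The shared column \<open>w\<close> is small in total, since it meets both others: each
  other column is large, hence has exactly \<open>M + 1\<close> rows by
  \<open>large_column_support\<close>. These two blocks of rows leave \<open>M - 1\<close> rows
  wholly to \<open>w\<close>. Comparing its largest entry in each block with its smallest positive
  entry over both gives the bound.\<close>

lemma shared_column_bound:
  fixes x y w :: "'p \<Rightarrow> nat" and M n e :: nat
  assumes fin: "finite P" and P: "card P = 3 * M + 1" and M: "M \<ge> 2" and n: "n \<ge> 1"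
    and e: "M * n < (3 * M + 4) * e"
    and row: "\<And>A. A \<in> P \<Longrightarrow> x A + y A + w A = n"
    and col_x: "\<And>A. A \<in> P \<Longrightarrow> x A > 0 \<Longrightarrow> sum x P + e \<le> M * n + x A"
    and col_y: "\<And>A. A \<in> P \<Longrightarrow> y A > 0 \<Longrightarrow> sum y P + e \<le> M * n + y A"
    and col_w: "\<And>A. A \<in> P \<Longrightarrow> w A > 0 \<Longrightarrow> sum w P + e \<le> M * n + w A"
    and xy: "\<And>A. A \<in> P \<Longrightarrow> x A = 0 \<or> y A = 0"
    and xw: "\<exists>A\<in>P. x A > 0 \<and> w A > 0" and yw: "\<exists>A\<in>P. y A > 0 \<and> w A > 0"
  shows "(3 * M + 1) * e \<le> M * n"
    and "n = 3 * e + c \<Longrightarrow> M * (c - 1) < e \<Longrightarrow> c dvd e"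
proof -
  have total: "sum x P + sum y P + sum w P = (3 * M + 1) * n"
    unfolding sum.distrib[symmetric] using row P by (simp cong: sum.cong)
  define Sx where "Sx = {A \<in> P. x A > 0}"
  define Sy where "Sy = {A \<in> P. y A > 0}"
  have S: "Sx \<subseteq> P" "Sy \<subseteq> P" "Sx \<inter> Sy = {}" "finite Sx" "finite Sy"
    using fin unfolding Sx_def Sy_def by (auto dest: xy)
  \<comment> \<open>A row shared by \<open>y\<close> and \<open>w\<close> limits the sum of these
    two columns; what remains of the total belongs to \<open>x\<close>.\<close>
  have large_x: "M * n + 2 * e \<le> sum x P"
  proof -
    obtain A where A: "A \<in> P" "y A > 0" "w A > 0" using yw by blast
    show ?thesis using col_y[OF A(1,2)] col_w[OF A(1,3)] row[OF A(1)] total by (simp add: algebra_simps)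
  qed
  have large_y: "M * n + 2 * e \<le> sum y P"
  proof -
    obtain A where A: "A \<in> P" "x A > 0" "w A > 0" using xw by blast
    show ?thesis using col_x[OF A(1,2)] col_w[OF A(1,3)] row[OF A(1)] total by (simp add: algebra_simps)
  qed
  have row_x: "x A + w A = n" if "A \<in> P" "x A > 0" for A using row[OF that(1)] xy[OF that(1)] that by simp
  have row_y: "y A + w A = n" if "A \<in> P" "y A > 0" for A using row[OF that(1)] xy[OF that(1)] that by simp
  note LX = large_column_support[OF fin n e row_x col_x large_x, folded Sx_def]
  note LY = large_column_support[OF fin n e row_y col_y large_y, folded Sy_def]
  obtain A where A: "A \<in> Sx" "\<And>B. B \<in> Sx \<Longrightarrow> w B \<le> w A" "e + w A \<le> sum w Sx" "e \<le> M * w A"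
    using LX(3) unfolding Sx_def by auto
  obtain B where B: "B \<in> Sy" "\<And>C. C \<in> Sy \<Longrightarrow> w C \<le> w B" "e + w B \<le> sum w Sy" "e \<le> M * w B"
    using LY(3) unfolding Sy_def by auto
  define T where "T = {A \<in> Sx \<union> Sy. w A > 0}"
  have "T \<noteq> {}" "finite T" using xw S unfolding T_def Sx_def by auto
  then have "Min (w ` T) \<in> w ` T" by (intro Min_in) auto
  then obtain C where "C \<in> T" "w C = Min (w ` T)" by auto
  then have C: "C \<in> T" "\<And>D. D \<in> T \<Longrightarrow> w C \<le> w D" using \<open>finite T\<close> by simp_all
  have CP: "C \<in> P" "w C > 0" using C(1) S unfolding T_def by auto
  have "sum w P = sum w (P - (Sx \<union> Sy)) + (sum w Sx + sum w Sy)"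
    using S fin sum.subset_diff[of "Sx \<union> Sy" P w] sum.union_disjoint[of Sx Sy w] by auto
  moreover have "sum w (P - (Sx \<union> Sy)) = (\<Sum>A\<in>P - (Sx \<union> Sy). n)"
  proof (rule sum.cong)
    fix A assume "A \<in> P - (Sx \<union> Sy)"
    then show "w A = n" using row[of A] by (simp add: Sx_def Sy_def)
  qed simp
  moreover have "card (P - (Sx \<union> Sy)) = M - 1"
    using S fin P LX(1) LY(1) by (simp add: card_Diff_subset card_Un_disjoint)
  ultimately have "sum w P = (M - 1) * n + (sum w Sx + sum w Sy)" by simp
  moreover have "M * n = (M - 1) * n + n" using M by (cases M) auto
  ultimately have main: "sum w Sx + sum w Sy + e \<le> n + w C"
    using col_w[OF CP] by linarith
  have wA: "w A > 0" and wB: "w B > 0"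
  proof -
    have "e > 0" using e by (cases e) auto
    then show "w A > 0" "w B > 0" using A(4) B(4) by (cases "w A"; cases "w B"; simp)+
  qed
  have CA: "w C \<le> w A" "w C \<le> w B" using C(2)[of A] C(2)[of B] A(1) B(1) wA wB unfolding T_def by auto
  have sum3: "3 * e + w A + w B \<le> n + w C" using main A(3) B(3) by linarith
  then have "3 * e + w B \<le> n" using CA by linarith
  then have "M * (3 * e + w B) \<le> M * n" by simp
  then show "(3 * M + 1) * e \<le> M * n" using B(4) by (simp add: algebra_simps)
  show "c dvd e" if c: "n = 3 * e + c" "M * (c - 1) < e"
  proof -
    have ge: "c \<le> b" if "e \<le> M * b" for b
    proof (rule ccontr)
      assume "\<not> c \<le> b"
      then have "M * b \<le> M * (c - 1)" by (intro mult_le_mono2) simp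
      then show False using c(2) that by linarith
    qed
    \<comment> \<open>No integer \<open>b\<close> below \<open>c\<close> satisfies
      \<open>e \<le> M * b\<close>, so both maxima are at least \<open>c\<close>, while
      \<open>sum3\<close> says w A + w B <= c + w C. Minimum and maxima therefore coincide, and
      every positive entry in the block is \<open>c\<close>.\<close>
    have eq: "w A = c" "w B = c" "w C = c"
      using sum3 c(1) CA ge[OF A(4)] ge[OF B(4)] by linarith+
    have "sum w Sx = e + c" using main A(3) B(3) eq c(1) by linarith
    moreover have "c dvd sum w Sx"
    proof (rule dvd_sum)
      fix D assume D: "D \<in> Sx"
      show "c dvd w D"
      proof (cases "w D = 0")
        case False
        then have "w C \<le> w D" using D C(2)[of D] unfolding T_def by auto
        then show ?thesis using A(2)[OF D] eq by simp
      qed simp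
    qed
    ultimately show ?thesis by simp
  qed
qed

text \<open>A colour class made of whole parts cannot have \<open>M + 1\<close> of them, because the
  column condition would then leave no room for the positive excess.\<close>

lemma pure_column_bound:
  fixes x :: "'p \<Rightarrow> nat"
  assumes "finite P" and e: "e > (0::nat)"
    and pure: "\<And>A. A \<in> P \<Longrightarrow> x A > 0 \<Longrightarrow> x A = n"
    and col: "\<And>A. A \<in> P \<Longrightarrow> x A > 0 \<Longrightarrow> sum x P + e \<le> M * n + x A"
  shows "sum x P \<le> M * n"
proof (cases "\<exists>A\<in>P. x A > 0")
  case True
  then obtain A where A: "A \<in> P" "x A > 0" by blast
  have "sum x P = (\<Sum>A\<in>P. if x A > 0 then n else 0)"
    by (rule sum.cong) (use pure in auto)
  also have "\<dots> = card {A \<in> P. x A > 0} * n" using assms(1) by (simp add: sum.If_cases Int_def)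
  finally have eq: "sum x P = card {A \<in> P. x A > 0} * n" .
  have "card {A \<in> P. x A > 0} * n < (M + 1) * n" using col[OF A] pure[OF A] e unfolding eq by simp
  then have "card {A \<in> P. x A > 0} < M + 1" by (rule mult_less_cancel2[THEN iffD1, THEN conjunct2])
  then show ?thesis unfolding eq by simp
qed (use assms in \<open>simp add: sum.neutral\<close>)

text \<open>The cases are the graphs on the three columns in which two columns are joined if they
  share a row. With exactly two joined pairs \<open>shared_column_bound\<close> applies; in all
  other cases adding up the column sums already contradicts their total.\<close>

lemma three_columns_contradiction:
  fixes x y w :: "'p \<Rightarrow> nat" and M n e :: nat
  assumes fin: "finite P" and P: "card P = 3 * M + 1" and M: "M \<ge> 2" and n: "n \<ge> 1"
    and e: "M * n < (3 * M + 4) * e"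
    and row: "\<And>A. A \<in> P \<Longrightarrow> x A + y A + w A = n"
    and col_x: "\<And>A. A \<in> P \<Longrightarrow> x A > 0 \<Longrightarrow> sum x P + e \<le> M * n + x A"
    and col_y: "\<And>A. A \<in> P \<Longrightarrow> y A > 0 \<Longrightarrow> sum y P + e \<le> M * n + y A"
    and col_w: "\<And>A. A \<in> P \<Longrightarrow> w A > 0 \<Longrightarrow> sum w P + e \<le> M * n + w A"
    and final: "M * n < (3 * M + 1) * e \<or> (\<exists>c. n = 3 * e + c \<and> M * (c - 1) < e \<and> \<not> c dvd e)"
  shows False
proof -
  have total: "sum x P + sum y P + sum w P = (3 * M + 1) * n"
    unfolding sum.distrib[symmetric] using row P by (simp cong: sum.cong)
  then have total': "sum x P + sum y P + sum w P = 3 * (M * n) + n" by (simp add: algebra_simps)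
  have pos: "e > 0" using e by (cases e) auto
  have n5: "n < 5 * e"
  proof -
    have "(3 * M + 4) * e \<le> (5 * M) * e" using M by (intro mult_le_mono1) simp
    then have "M * n < (5 * M) * e" using e by linarith
    then have "M * n < M * (5 * e)" by (simp only: mult.assoc mult.left_commute)
    then show ?thesis by simp
  qed
  have hub: False
    if "\<And>A. A \<in> P \<Longrightarrow> f A + g A + h A = n"
      and "\<And>A. A \<in> P \<Longrightarrow> f A > 0 \<Longrightarrow> sum f P + e \<le> M * n + f A"
      and "\<And>A. A \<in> P \<Longrightarrow> g A > 0 \<Longrightarrow> sum g P + e \<le> M * n + g A"
      and "\<And>A. A \<in> P \<Longrightarrow> h A > 0 \<Longrightarrow> sum h P + e \<le> M * n + h A"
      and "\<not> (\<exists>A\<in>P. f A > 0 \<and> g A > 0)"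
      and "\<exists>A\<in>P. f A > 0 \<and> h A > 0" and "\<exists>A\<in>P. g A > 0 \<and> h A > 0"
    for f g h :: "'p \<Rightarrow> nat"
  proof -
    have fg: "f A = 0 \<or> g A = 0" if "A \<in> P" for A
      using \<open>\<not> (\<exists>A\<in>P. f A > 0 \<and> g A > 0)\<close> that by auto
    note B = shared_column_bound[OF fin P M n e that(1,2,3,4) fg that(6,7)]
    from final show False
    proof
      assume "M * n < (3 * M + 1) * e"
      then show False using B(1) by linarith
    next
      assume "\<exists>c. n = 3 * e + c \<and> M * (c - 1) < e \<and> \<not> c dvd e"
      then show False using B(2) by blast
    qed
  qed
  have pure: "sum f P \<le> M * n"
    if "\<And>A. A \<in> P \<Longrightarrow> f A + g A + h A = n"
      and "\<And>A. A \<in> P \<Longrightarrow> f A > 0 \<Longrightarrow> sum f P + e \<le> M * n + f A"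
      and "\<not> (\<exists>A\<in>P. f A > 0 \<and> g A > 0)" and "\<not> (\<exists>A\<in>P. f A > 0 \<and> h A > 0)"
    for f g h :: "'p \<Rightarrow> nat"
    by (rule pure_column_bound[OF fin pos _ that(2)]) (use that(1,3,4) in fastforce)+
  have share: "sum f P + sum g P + 2 * e \<le> 2 * (M * n) + n"
    if "\<And>A. A \<in> P \<Longrightarrow> f A + g A \<le> n"
      and "\<And>A. A \<in> P \<Longrightarrow> f A > 0 \<Longrightarrow> sum f P + e \<le> M * n + f A"
      and "\<And>A. A \<in> P \<Longrightarrow> g A > 0 \<Longrightarrow> sum g P + e \<le> M * n + g A"
      and fg: "\<exists>A\<in>P. f A > 0 \<and> g A > 0"
    for f g :: "'p \<Rightarrow> nat"
  proof -
    obtain A where A: "A \<in> P" "f A > 0" "g A > 0" using fg by blast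
    show ?thesis using that(1)[OF A(1)] that(2)[OF A(1,2)] that(3)[OF A(1,3)] by linarith
  qed
  have rows: "x A + w A + y A = n" "y A + w A + x A = n" "w A + x A + y A = n" "y A + x A + w A = n"
    "x A + y A \<le> n" "x A + w A \<le> n" "y A + w A \<le> n" if "A \<in> P" for A
    using row[OF that] by linarith+
  define XY where "XY \<longleftrightarrow> (\<exists>A\<in>P. x A > 0 \<and> y A > 0)"
  define XW where "XW \<longleftrightarrow> (\<exists>A\<in>P. x A > 0 \<and> w A > 0)"
  define YW where "YW \<longleftrightarrow> (\<exists>A\<in>P. y A > 0 \<and> w A > 0)"
  have comm: "(\<exists>A\<in>P. y A > 0 \<and> x A > 0) = XY" "(\<exists>A\<in>P. w A > 0 \<and> x A > 0) = XW"
    "(\<exists>A\<in>P. w A > 0 \<and> y A > 0) = YW"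
    unfolding XY_def XW_def YW_def by auto
  have hubs: "\<not> (\<not> XY \<and> XW \<and> YW)" "\<not> (XY \<and> \<not> XW \<and> YW)" "\<not> (XY \<and> XW \<and> \<not> YW)"
    using hub[of x y w, OF row col_x col_y col_w] hub[of x w y, OF rows(1) col_x col_w col_y]
      hub[of y w x, OF rows(2) col_y col_w col_x] comm
    unfolding XY_def XW_def YW_def by blast+
  have pure_x: "sum x P \<le> M * n" if "\<not> XY" "\<not> XW"
    by (rule pure[of x y w, OF row col_x]) (use that in \<open>simp_all add: XY_def XW_def\<close>)
  have pure_y: "sum y P \<le> M * n" if "\<not> XY" "\<not> YW"
    by (rule pure[of y x w, OF rows(4) col_y]) (use that comm in \<open>simp_all add: YW_def\<close>)
  have pure_w: "sum w P \<le> M * n" if "\<not> XW" "\<not> YW"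
    by (rule pure[of w x y, OF rows(3) col_w]) (use that comm in simp_all)
  have share_xy: "sum x P + sum y P + 2 * e \<le> 2 * (M * n) + n" if XY
    by (rule share[of x y, OF rows(5) col_x col_y]) (use that in \<open>simp_all add: XY_def\<close>)
  have share_xw: "sum x P + sum w P + 2 * e \<le> 2 * (M * n) + n" if XW
    by (rule share[of x w, OF rows(6) col_x col_w]) (use that in \<open>simp_all add: XW_def\<close>)
  have share_yw: "sum y P + sum w P + 2 * e \<le> 2 * (M * n) + n" if YW
    by (rule share[of y w, OF rows(7) col_y col_w]) (use that in \<open>simp_all add: YW_def\<close>)
  consider "XY" "XW" "YW" | "XY" "\<not> XW" "\<not> YW" | "\<not> XY" "XW" "\<not> YW"
    | "\<not> XY" "\<not> XW" "YW" | "\<not> XY" "\<not> XW" "\<not> YW"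
    using hubs by blast
  then show False
  proof cases
    case 1
    \<comment> \<open>Adding the three pair bounds counts every column twice and gives 6e <= n,
      against \<open>n5\<close>.\<close>
    show ?thesis using share_xy[OF 1(1)] share_xw[OF 1(2)] share_yw[OF 1(3)] total' n5 by linarith
  next
    case 2
    show ?thesis using share_xy[OF 2(1)] pure_w[OF 2(2,3)] total' pos by linarith
  next
    case 3
    show ?thesis using share_xw[OF 3(2)] pure_y[OF 3(1,3)] total' pos by linarith
  next
    case 4
    show ?thesis using share_yw[OF 4(3)] pure_x[OF 4(1,2)] total' pos by linarith
  next
    case 5
    show ?thesis using pure_x[OF 5(1,2)] pure_y[OF 5(1,3)] pure_w[OF 5(2,3)] total' n by linarith
  qed
qed

section \<open>Independent transversals\<close>

definition transversal :: "('a \<Rightarrow> 'a \<Rightarrow> bool) \<Rightarrow> 'a set set \<Rightarrow> ('a set \<Rightarrow> 'a) \<Rightarrow> bool" where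
  "transversal H \<C> \<tau> \<longleftrightarrow> (\<forall>C\<in>\<C>. \<tau> C \<in> C) \<and> (\<forall>C\<in>\<C>. \<forall>D\<in>\<C>. \<not> H (\<tau> C) (\<tau> D))"

text \<open>Haxell's exchange argument. A state is a transversal \<open>\<tau>\<close> of \<open>\<D>\<close> with a list of vertices, each one
  undominated by its predecessors and the transversal elements they meet, so that the sets \<open>W\<close> of
  classes met are disjoint. A vertex meeting nothing is exchanged into \<open>\<tau>\<close>, which shrinks an earlier
  \<open>W\<close>; otherwise the list is extended. Either way the sequence of sizes drops lexicographically.\<close>

lemma transversal_insert:
  fixes H :: "'a \<Rightarrow> 'a \<Rightarrow> bool"
  assumes fin: "finite \<D>" and A: "A \<notin> \<D>"
    and sym: "\<And>x y. H x y \<Longrightarrow> H y x" and irrefl: "\<And>x. \<not> H x x"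
    and undominated: "\<And>\<J> X. \<J> \<subseteq> insert A \<D> \<Longrightarrow> A \<in> \<J> \<Longrightarrow> finite X \<Longrightarrow> card X \<le> 2 * (card \<J> - 1) \<Longrightarrow>
      \<exists>C\<in>\<J>. \<exists>x\<in>C. \<forall>y\<in>X. \<not> H x y"
    and \<tau>: "transversal H \<D> \<tau>"
  shows "\<exists>\<sigma>. transversal H (insert A \<D>) \<sigma>"
proof -
  define W where "W \<tau> x = {C \<in> \<D>. H x (\<tau> C)}" for \<tau> x
  define adm where "adm \<tau> xs \<longleftrightarrow> transversal H \<D> \<tau> \<and> xs \<noteq> [] \<and>
      (\<forall>i<length xs. (\<exists>C\<in>insert A (\<Union>l<i. W \<tau> (xs ! l)). xs ! i \<in> C) \<and>
        (\<forall>l<i. \<not> H (xs ! i) (xs ! l) \<and> W \<tau> (xs ! i) \<inter> W \<tau> (xs ! l) = {}) \<and>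
        (Suc i < length xs \<longrightarrow> W \<tau> (xs ! i) \<noteq> {}))" for \<tau> xs
  define M where "M = Suc (card \<D>)"
  \<comment> \<open>The sizes are padded to the fixed length \<open>M\<close> with \<open>M\<close>,
    which exceeds each of them. Appending an entry thus lowers one position, and on lists of fixed
    length the lexicographic order is well-founded.\<close>
  define \<mu> where "\<mu> \<tau> xs = map (\<lambda>i. if i < length xs then card (W \<tau> (xs ! i)) else M) [0..<M]" for \<tau> xs
  have finW: "finite (W \<tau> x)" and W_sub: "W \<tau> x \<subseteq> \<D>" for \<tau> x
    unfolding W_def using fin by auto
  have W_card: "card (W \<tau> x) < M" for \<tau> x
    unfolding M_def using card_mono[OF fin W_sub] by (simp add: less_Suc_eq_le)
  have smaller: "(\<mu> \<tau>' xs', \<mu> \<tau> xs) \<in> lexn less_than M"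
    if i: "i < M" and eq: "\<And>l. l < i \<Longrightarrow> \<mu> \<tau>' xs' ! l = \<mu> \<tau> xs ! l" and lt: "\<mu> \<tau>' xs' ! i < \<mu> \<tau> xs ! i"
    for i \<tau> \<tau>' xs xs'
  proof -
    have len: "length (\<mu> \<tau>' xs') = M" "length (\<mu> \<tau> xs) = M" unfolding \<mu>_def by auto
    have "take i (\<mu> \<tau>' xs') = take i (\<mu> \<tau> xs)"
      by (rule nth_equalityI) (use len i eq in auto)
    then show ?thesis
      unfolding lexn_conv using i len lt id_take_nth_drop[of i "\<mu> \<tau>' xs'"] id_take_nth_drop[of i "\<mu> \<tau> xs"]
      by auto
  qed
  have "adm \<tau> xs \<longrightarrow> (\<exists>\<sigma>. transversal H (insert A \<D>) \<sigma>)" for \<tau> xs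
  proof (induction "(\<tau>, xs)" arbitrary: \<tau> xs
      rule: wf_induct_rule[OF wf_inv_image[OF wf_lexn[OF wf_less_than], of M "\<lambda>(\<tau>, xs). \<mu> \<tau> xs"]])
    case (1 \<tau> xs)
    have IH: "\<exists>\<sigma>. transversal H (insert A \<D>) \<sigma>" if "adm \<tau>' xs'" "(\<mu> \<tau>' xs', \<mu> \<tau> xs) \<in> lexn less_than M" for \<tau>' xs'
      using 1 that by (auto simp: in_inv_image)
    show ?case
    proof
      assume adm: "adm \<tau> xs"
      then have tr: "transversal H \<D> \<tau>" and ne: "xs \<noteq> []"
        and mem: "\<And>i. i < length xs \<Longrightarrow> \<exists>C\<in>insert A (\<Union>l<i. W \<tau> (xs ! l)). xs ! i \<in> C"
        and disj: "\<And>i l. i < length xs \<Longrightarrow> l < i \<Longrightarrow> \<not> H (xs ! i) (xs ! l) \<and> W \<tau> (xs ! i) \<inter> W \<tau> (xs ! l) = {}"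
        and nonempty: "\<And>i. Suc i < length xs \<Longrightarrow> W \<tau> (xs ! i) \<noteq> {}"
        unfolding adm_def by auto
      define j where "j = length xs - 1"
      have j: "length xs = Suc j" using ne unfolding j_def by (cases xs) auto
      define U where "U = (\<Union>l<length xs. W \<tau> (xs ! l))"
      have U_sub: "U \<subseteq> \<D>" unfolding U_def using W_sub by blast
      have card_U: "card U = (\<Sum>l<length xs. card (W \<tau> (xs ! l)))"
        unfolding U_def by (rule card_UN_disjoint) (use finW disj in \<open>auto, metis IntI empty_iff nat_neq_iff\<close>)
      have "card U \<le> card \<D>" using card_mono[OF fin U_sub] .
      show "\<exists>\<sigma>. transversal H (insert A \<D>) \<sigma>"
      proof (cases "W \<tau> (xs ! j) = {}")
        case True
        then have free: "\<not> H (xs ! j) (\<tau> C)" "\<not> H (\<tau> C) (xs ! j)" if "C \<in> \<D>" for C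
          using that sym unfolding W_def by blast+
        have upd: "transversal H \<D> (\<tau>(C := xs ! j))" if "xs ! j \<in> C" for C
          using tr that free irrefl unfolding transversal_def by auto
        obtain C where C: "C = A \<or> C \<in> (\<Union>l<j. W \<tau> (xs ! l))" "xs ! j \<in> C" using mem[of j] j by auto
        from C(1) show ?thesis
        proof
          assume "C = A"
          then have "transversal H (insert A \<D>) (\<tau>(A := xs ! j))"
            using tr C(2) free irrefl A unfolding transversal_def by auto
          then show ?thesis by blast
        next
          assume "C \<in> (\<Union>l<j. W \<tau> (xs ! l))"
          then obtain i where i: "i < j" "C \<in> W \<tau> (xs ! i)" by auto
          define \<tau>' where "\<tau>' = \<tau>(C := xs ! j)"
          define xs' where "xs' = take (Suc i) xs"
          have len': "length xs' = Suc i" and nth': "\<And>l. l \<le> i \<Longrightarrow> xs' ! l = xs ! l"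
            unfolding xs'_def using i j by auto
          have nH: "\<not> H (xs ! l) (xs ! j)" if "l < j" for l
            using disj[of j l] that j sym[of "xs ! l" "xs ! j"] by auto
          \<comment> \<open>The new value at \<open>C\<close> is not \<open>H\<close>-adjacent to
            the kept entries, so the exchange can only delete \<open>C\<close> from their sets
            \<open>W\<close>. Those sets are disjoint and \<open>C\<close> belongs to the one at
            \<open>i\<close>; the first change in the sequence of sizes is a drop at
            \<open>i\<close>.\<close>
          have W'_less: "W \<tau>' (xs ! l) = W \<tau> (xs ! l)" if "l < i" for l
            using disj[of i l] i that nH[of l] j unfolding W_def \<tau>'_def by auto
          have W'_i: "W \<tau>' (xs ! i) = W \<tau> (xs ! i) - {C}"
            using i nH[of i] unfolding W_def \<tau>'_def by auto
          have "adm \<tau>' xs'"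
            unfolding adm_def
          proof (intro conjI allI impI)
            show "transversal H \<D> \<tau>'" using upd[OF C(2)] unfolding \<tau>'_def .
            show "xs' \<noteq> []" using len' by auto
          next
            fix l assume l: "l < length xs'"
            then have l: "l \<le> i" "l < length xs" using len' i j by auto
            have "(\<Union>k<l. W \<tau>' (xs' ! k)) = (\<Union>k<l. W \<tau> (xs ! k))"
              using l nth' W'_less by (intro SUP_cong) auto
            then show "\<exists>C\<in>insert A (\<Union>k<l. W \<tau>' (xs' ! k)). xs' ! l \<in> C"
              using mem[OF l(2)] nth'[OF l(1)] by simp
            show "\<not> H (xs' ! l) (xs' ! k)" if "k < l" for k
              using disj[OF l(2) that] nth' l that by simp
            show "W \<tau>' (xs' ! l) \<inter> W \<tau>' (xs' ! k) = {}" if "k < l" for k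
              using disj[OF l(2) that] nth' l that W'_less W'_i by (cases "l = i") auto
            show "W \<tau>' (xs' ! l) \<noteq> {}" if "Suc l < length xs'"
              using that len' i j nth' W'_less nonempty by simp
          qed
          moreover have "(\<mu> \<tau>' xs', \<mu> \<tau> xs) \<in> lexn less_than M"
          proof (rule smaller)
            have "card (W \<tau> (xs ! l)) \<noteq> 0" if "l < j" for l
              using nonempty[of l] j that finW by auto
            then have "j \<le> (\<Sum>l<j. card (W \<tau> (xs ! l)))"
              using sum_bounded_below[of "{..<j}" 1 "\<lambda>l. card (W \<tau> (xs ! l))"] by (auto simp: Suc_le_eq)
            also have "\<dots> \<le> card U" unfolding card_U j by simp
            also note \<open>card U \<le> card \<D>\<close>
            finally show iM: "i < M" using i unfolding M_def by simp
            show "\<mu> \<tau>' xs' ! l = \<mu> \<tau> xs ! l" if "l < i" for l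
              using that iM len' nth' W'_less i j unfolding \<mu>_def by simp
            have "card (W \<tau> (xs ! i) - {C}) < card (W \<tau> (xs ! i))"
              by (rule card_Diff1_less[OF finW i(2)])
            then show "\<mu> \<tau>' xs' ! i < \<mu> \<tau> xs ! i"
              using iM len' nth' W'_i i j unfolding \<mu>_def by simp
          qed
          ultimately show ?thesis by (rule IH)
        qed
      next
        case False
        then have allne: "W \<tau> (xs ! l) \<noteq> {}" if "l < length xs" for l
          using nonempty[of l] that j by (cases "l = j") auto
        have "card (W \<tau> (xs ! l)) \<noteq> 0" if "l < length xs" for l
          using allne[OF that] finW by auto
        \<comment> \<open>Disjoint nonempty sets \<open>W\<close> make the list no longer than
          \<open>U\<close>. Hence the list and the transversal elements on \<open>U\<close> together
          have at most \<open>2 * card U\<close> members, just what \<open>undominated\<close>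
          allows for \<open>insert A U\<close>.\<close>
        then have len_le: "length xs \<le> card U"
          unfolding card_U using sum_bounded_below[of "{..<length xs}" 1 "\<lambda>l. card (W \<tau> (xs ! l))"]
          by (auto simp: Suc_le_eq)
        have finU: "finite U" using U_sub fin finite_subset by blast
        have "A \<notin> U" using U_sub A by blast
        then have card_J: "card (insert A U) = Suc (card U)" using finU by simp
        define X where "X = set xs \<union> \<tau> ` U"
        have "card X \<le> card (set xs) + card (\<tau> ` U)" unfolding X_def by (rule card_Un_le)
        also have "\<dots> \<le> length xs + card U" using card_length card_image_le[OF finU] add_mono by blast
        finally have "card X \<le> 2 * (card (insert A U) - 1)" using len_le card_J by simp
        moreover have "insert A U \<subseteq> insert A \<D>" "A \<in> insert A U" "finite X"
          using U_sub finU unfolding X_def by auto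
        ultimately obtain C x where x: "C \<in> insert A U" "x \<in> C" "\<And>y. y \<in> X \<Longrightarrow> \<not> H x y"
          using undominated[of "insert A U" X] by blast
        have "adm \<tau> (xs @ [x])"
          unfolding adm_def
        proof (intro conjI allI impI)
          fix i assume "i < length (xs @ [x])"
          then have i: "i < length xs \<or> i = length xs" by auto
          have eq: "(xs @ [x]) ! k = xs ! k" if "k < i" for k
            using i that by (auto simp: nth_append)
          have U_eq: "(\<Union>k<i. W \<tau> ((xs @ [x]) ! k)) = (\<Union>k<i. W \<tau> (xs ! k))"
            using eq by simp
          show "\<exists>C\<in>insert A (\<Union>k<i. W \<tau> ((xs @ [x]) ! k)). (xs @ [x]) ! i \<in> C"
            unfolding U_eq using i mem x unfolding U_def by (auto simp: nth_append)
          show "\<not> H ((xs @ [x]) ! i) ((xs @ [x]) ! k)" if "k < i" for k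
            using i that disj x(3) eq[OF that] unfolding X_def by (auto simp: nth_append)
          show "W \<tau> ((xs @ [x]) ! i) \<inter> W \<tau> ((xs @ [x]) ! k) = {}" if "k < i" for k
            using i
          proof
            assume "i = length xs"
            moreover have "\<not> H x (\<tau> D)" if "D \<in> W \<tau> (xs ! k)" for D
              using that x(3)[of "\<tau> D"] \<open>k < i\<close> \<open>i = length xs\<close> unfolding X_def U_def by auto
            ultimately show ?thesis using eq[OF that] unfolding W_def by auto
          qed (use disj that eq in \<open>simp add: nth_append\<close>)
          show "W \<tau> ((xs @ [x]) ! i) \<noteq> {}" if "Suc i < length (xs @ [x])"
            using that allne by (simp add: nth_append)
        qed (use tr in auto)
        moreover have "(\<mu> \<tau> (xs @ [x]), \<mu> \<tau> xs) \<in> lexn less_than M"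
        proof (rule smaller)
          show iM: "length xs < M" using len_le \<open>card U \<le> card \<D>\<close> unfolding M_def by simp
          show "\<mu> \<tau> (xs @ [x]) ! l = \<mu> \<tau> xs ! l" if "l < length xs" for l
            using that iM unfolding \<mu>_def by (simp add: nth_append)
          show "\<mu> \<tau> (xs @ [x]) ! length xs < \<mu> \<tau> xs ! length xs"
            using iM W_card unfolding \<mu>_def by (simp add: nth_append)
        qed
        ultimately show ?thesis by (rule IH)
      qed
    qed
  qed
  moreover obtain x where "x \<in> A" using undominated[of "{A}" "{}"] by auto
  then have "adm \<tau> [x]" unfolding adm_def using \<tau> by auto
  ultimately show ?thesis by blast
qed

text \<open>The usual condition \<open>2 * k \<le> n\<close> is sharpened by the number of classes:
  one more class needs two dominating vertices fewer than twice the number of classes. For four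
  classes this gives \<open>3 * k < 2 * n\<close>.\<close>

theorem haxell_transversal:
  fixes H :: "'a \<Rightarrow> 'a \<Rightarrow> bool"
  assumes "finite \<C>" and "disjoint \<C>" and size: "\<And>C. C \<in> \<C> \<Longrightarrow> finite C \<and> card C = n"
    and sym: "\<And>x y. H x y \<Longrightarrow> H y x" and irrefl: "\<And>x. \<not> H x x"
    and deg: "\<And>y. finite {x. H y x} \<and> card {x. H y x} \<le> k"
    and bound: "2 * (card \<C> - 1) * k < card \<C> * n"
  shows "\<exists>\<tau>. transversal H \<C> \<tau>"
proof -
  have "\<D> \<subseteq> \<C> \<Longrightarrow> \<exists>\<tau>. transversal H \<D> \<tau>" if "finite \<D>" for \<D>
    using that
  proof (induction \<D> rule: finite_induct)
    case empty
    then show ?case by (simp add: transversal_def)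
  next
    case (insert A \<D>)
    then obtain \<tau> where \<tau>: "transversal H \<D> \<tau>" by auto
    show ?case
    proof (rule transversal_insert[OF insert.hyps(1,2) sym irrefl _ \<tau>])
      fix \<J> and X :: "'a set"
      assume J: "\<J> \<subseteq> insert A \<D>" "A \<in> \<J>" and X: "finite X" "card X \<le> 2 * (card \<J> - 1)"
      have JC: "\<J> \<subseteq> \<C>" using J insert.prems by blast
      then have finJ: "finite \<J>" using assms(1) finite_subset by blast
      show "\<exists>C\<in>\<J>. \<exists>x\<in>C. \<forall>y\<in>X. \<not> H x y"
      proof (rule ccontr)
        assume "\<not> ?thesis"
        then have "\<Union>\<J> \<subseteq> (\<Union>y\<in>X. {x. H y x})" using sym by blast
        then have "card (\<Union>\<J>) \<le> card (\<Union>y\<in>X. {x. H y x})" using X deg by (intro card_mono) auto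
        also have "\<dots> \<le> (\<Sum>y\<in>X. card {x. H y x})" using X(1) by (rule card_UN_le)
        also have "\<dots> \<le> card X * k" using sum_bounded_above[of X _ k] deg by simp
        also have "\<dots> \<le> 2 * (card \<J> - 1) * k" using X(2) by simp
        finally have "card (\<Union>\<J>) \<le> 2 * (card \<J> - 1) * k" .
        moreover have "card (\<Union>\<J>) = card \<J> * n"
          using card_Union_disjoint[of \<J>] JC assms(2) size
          by (metis (no_types, lifting) pairwise_subset subsetD sum.cong sum_constant mult.commute
              of_nat_id)
        ultimately have le: "card \<J> * n \<le> 2 * (card \<J> - 1) * k" by simp
        have "card \<J> \<le> card \<C>" using card_mono[OF assms(1) JC] .
        moreover have "0 < card \<J>" using J(2) finJ card_gt_0_iff by blast
        \<comment> \<open>The fraction (t - 1)/t grows with t, so the numerical condition for all of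
          \<open>\<C>\<close> implies it for every nonempty subfamily.\<close>
        ultimately have "(card \<J> - 1) * card \<C> \<le> (card \<C> - 1) * card \<J>"
          by (cases "card \<J>"; cases "card \<C>") auto
        then have "2 * (card \<J> - 1) * k * card \<C> \<le> 2 * (card \<C> - 1) * k * card \<J>"
          using mult_le_mono2[of "(card \<J> - 1) * card \<C>" "(card \<C> - 1) * card \<J>" "2 * k"]
          by (simp add: ac_simps)
        also have "\<dots> < card \<C> * n * card \<J>" using bound \<open>0 < card \<J>\<close> by simp
        finally show False using mult_le_mono1[OF le, of "card \<C>"] by (simp add: ac_simps)
      qed
    qed
  qed
  then show ?thesis using assms(1) by blast
qed

section \<open>Upper bounds for the extremal function\<close>

lemma card_4_E:
  assumes "card S = 4"
  obtains a b c d where "S = {a, b, c, d}" "a \<noteq> b" "a \<noteq> c" "a \<noteq> d" "b \<noteq> c" "b \<noteq> d" "c \<noteq> d"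
proof -
  obtain a T where T: "S = insert a T" "a \<notin> T" "card T = 3"
    using assms card_eq_SucD[of S 3] by auto
  then obtain b c d where "T = {b, c, d}" "b \<noteq> c" "c \<noteq> d" "b \<noteq> d" by (auto simp: card_3_iff)
  then show thesis using T that[of a b c d] by auto
qed

context balanced_K4_free
begin

theorem degree_bound_mod_1:
  assumes P: "card P = 3 * M + 1" and M: "M \<ge> 2" and n: "n \<ge> 1"
    and "n < 4 * e" and "M * n < (3 * M + 4) * e"
    and "M * n < (3 * M + 1) * e \<or> (\<exists>c. n = 3 * e + c \<and> M * (c - 1) < e \<and> \<not> c dvd e)"
  shows "d < 2 * M * n + e"
proof (rule ccontr)
  assume "\<not> ?thesis"
  then have d: "2 * (M * n) + e \<le> d" by simp
  then have "(2 * (M + 1) - 2) * n + e \<le> d" by simp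
  then obtain I X Y where parts: "I \<union> X \<union> Y = V" "I \<inter> X = {}" "I \<inter> Y = {}" "X \<inter> Y = {}"
    and indep: "\<forall>u\<in>I. \<forall>v\<in>I. \<not> G u v" "\<forall>u\<in>X. \<forall>v\<in>X. \<not> G u v" "\<forall>u\<in>Y. \<forall>v\<in>Y. \<not> G u v"
    using three_colouring_mod_1[of "M + 1" e] assms by auto
  have col: "(\<Sum>A\<in>P. card (S \<inter> A)) + e \<le> M * n + card (S \<inter> A)"
    if "S \<subseteq> V" "\<forall>u\<in>S. \<forall>v\<in>S. \<not> G u v" "A \<in> P" "card (S \<inter> A) > 0" for S A
  proof -
    obtain v where "v \<in> S" "v \<in> A" using \<open>card (S \<inter> A) > 0\<close> by (metis Int_iff card_gt_0_iff ex_in_conv)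
    then have "d + card S + n \<le> card P * n + card (S \<inter> A)"
      using independent_part_bound[of S v A] that by blast
    moreover have "card P * n = 3 * (M * n) + n" using P by (simp add: algebra_simps)
    ultimately show ?thesis using d sum_parts[OF that(1)] by linarith
  qed
  have row: "card (I \<inter> A) + card (X \<inter> A) + card (Y \<inter> A) = n" if "A \<in> P" for A
  proof -
    have "A = I \<inter> A \<union> X \<inter> A \<union> Y \<inter> A" using parts(1) part_subset[OF that] by blast
    then have "n = card (I \<inter> A \<union> X \<inter> A \<union> Y \<inter> A)" using part_card[OF that] by simp
    also have "\<dots> = card (I \<inter> A) + card (X \<inter> A) + card (Y \<inter> A)"
      using finite_part[OF that] parts by (subst card_Un_disjoint; auto)+
    finally show ?thesis by simp
  qed
  have sub: "I \<subseteq> V" "X \<subseteq> V" "Y \<subseteq> V" using parts by auto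
  show False
    by (rule three_columns_contradiction[OF finite_P P M n assms(5) row
          col[OF sub(1) indep(1)] col[OF sub(2) indep(2)] col[OF sub(3) indep(3)] assms(6)])
qed

text \<open>A vertex of degree at least \<open>3 * n - k\<close> misses at most \<open>k\<close>
  vertices in the three other parts. An independent transversal of this non-adjacency relation
  \<open>H\<close> is a K4.\<close>

theorem degree_bound_4:
  assumes P: "card P = 4" and k: "3 * k < 2 * n"
  shows "d + k < 3 * n"
proof (rule ccontr)
  assume "\<not> ?thesis"
  then have d: "3 * n \<le> d + k" by simp
  define H where "H u v \<longleftrightarrow> u \<in> V \<and> v \<in> V \<and> \<not> G u v \<and> (\<forall>A\<in>P. u \<in> A \<longrightarrow> v \<notin> A)" for u v
  have deg: "finite {x. H y x} \<and> card {x. H y x} \<le> k" for y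
  proof (cases "y \<in> V")
    case True
    then obtain A where A: "A \<in> P" "y \<in> A" by (rule obtain_part)
    have sub: "{x. H y x} \<subseteq> V - (nb y \<union> A)"
    proof
      fix x assume "x \<in> {x. H y x}"
      then have "x \<in> V" "\<not> G y x" "x \<notin> A" using A unfolding H_def by simp_all
      then show "x \<in> V - (nb y \<union> A)" by simp
    qed
    have "nb y \<inter> A = {}" using part_indep[OF A] by auto
    then have "card (nb y \<union> A) = card (nb y) + n"
      using finite_part[OF A(1)] part_card[OF A(1)] by (simp add: card_Un_disjoint)
    moreover have "nb y \<union> A \<subseteq> V" using nb_subset part_subset[OF A(1)] by blast
    then have "card (V - (nb y \<union> A)) = card V - card (nb y \<union> A)"
      using finite_part[OF A(1)] by (simp add: card_Diff_subset)
    ultimately have "card (V - (nb y \<union> A)) \<le> k" using card_V P d min_deg[OF True] by simp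
    then show ?thesis
      using card_mono[OF _ sub] finite_subset[OF sub] finite_V by (meson finite_Diff le_trans)
  next
    case False
    then have "{x. H y x} = {}" unfolding H_def by auto
    then show ?thesis by simp
  qed
  have H_sym: "H y x" if "H x y" for x y
    using that G_sym[of y x] unfolding H_def by auto
  have H_irrefl: "\<not> H x x" for x
  proof
    assume "H x x"
    then have "x \<in> V" "\<forall>A\<in>P. x \<notin> A" unfolding H_def by auto
    then show False using obtain_part by blast
  qed
  obtain \<tau> where \<tau>: "transversal H P \<tau>"
    using haxell_transversal[OF finite_P partition_onD2[OF partition] _ H_sym H_irrefl deg, of n]
      P k finite_part part_card by auto
  obtain A B C D where P4: "P = {A, B, C, D}" "A \<noteq> B" "A \<noteq> C" "A \<noteq> D" "B \<noteq> C" "B \<noteq> D" "C \<noteq> D"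
    using card_4_E[OF P] .
  have adj: "G (\<tau> X) (\<tau> Y)" if "X \<in> P" "Y \<in> P" "X \<noteq> Y" for X Y
  proof -
    have in_XY: "\<tau> X \<in> X" "\<tau> Y \<in> Y" and "\<not> H (\<tau> X) (\<tau> Y)"
      using \<tau> that unfolding transversal_def by auto
    moreover have "\<forall>Z\<in>P. \<tau> X \<in> Z \<longrightarrow> \<tau> Y \<notin> Z"
    proof (intro ballI impI notI)
      fix Z assume "Z \<in> P" "\<tau> X \<in> Z" "\<tau> Y \<in> Z"
      then have "X = Z" "Y = Z"
        using in_XY that partition_onD2[OF partition] unfolding disjoint_def by blast+
      then show False using that by simp
    qed
    ultimately show ?thesis using part_subset that unfolding H_def by blast
  qed
  show False
    by (rule no_K4[of "\<tau> A" "\<tau> B" "\<tau> C" "\<tau> D"]) (use P4 adj in auto)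
qed

end

section \<open>From edge sets to the graph locales, and the maximum defining the extremal
  function\<close>

lemma simple_graph_edge:
  assumes "simple_graph V E" "{u, v} \<in> E"
  shows "u \<in> V" "v \<in> V" "u \<noteq> v"
proof -
  have "{u, v} \<subseteq> V" "card {u, v} = 2" using assms unfolding simple_graph_def by blast+
  then show "u \<in> V" "v \<in> V" "u \<noteq> v" by auto
qed

lemma vertex_degree_eq:
  assumes "simple_graph V E"
  shows "vertex_degree E v = card {u. {v, u} \<in> E}"
proof -
  have "{e \<in> E. v \<in> e} = (\<lambda>u. {v, u}) ` {u. {v, u} \<in> E}"
  proof
    show "{e \<in> E. v \<in> e} \<subseteq> (\<lambda>u. {v, u}) ` {u. {v, u} \<in> E}"
    proof
      fix e assume "e \<in> {e \<in> E. v \<in> e}"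
      then have e: "e \<in> E" "v \<in> e" "card e = 2" using assms unfolding simple_graph_def by auto
      then obtain x y where "e = {x, y}" by (meson card_2_iff)
      with e show "e \<in> (\<lambda>u. {v, u}) ` {u. {v, u} \<in> E}" by (auto simp: insert_commute)
    qed
  qed auto
  moreover have "inj_on (\<lambda>u. {v, u}) {u. {v, u} \<in> E}"
    by (auto simp: inj_on_def doubleton_eq_iff)
  ultimately show ?thesis unfolding vertex_degree_def by (simp add: card_image)
qed

lemma balanced_K4_free_of_graph:
  assumes b: "balanced_multipartite n r V E" and K: "\<not> contains_complete 4 V E"
  shows "\<exists>P. balanced_K4_free V (\<lambda>u v. {u, v} \<in> E) P n (min_degree V E) \<and> card P = r"
proof -
  have sg: "simple_graph V E" using b unfolding balanced_multipartite_def by blast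
  note edge = simple_graph_edge[OF sg]
  have fin: "finite V" using sg unfolding simple_graph_def by blast
  obtain P where P: "partition_on V P" "card P = r" "\<And>A. A \<in> P \<Longrightarrow> card A = n"
    "\<And>A. A \<in> P \<Longrightarrow> independent_set E A"
    using b unfolding balanced_multipartite_def by blast
  interpret fin_graph V "\<lambda>u v. {u, v} \<in> E"
  proof
    show "\<not> {v, v} \<in> E" for v using edge(3)[of v v] by blast
  qed (use fin edge(1) in \<open>simp_all add: insert_commute\<close>)
  have "balanced_K4_free V (\<lambda>u v. {u, v} \<in> E) P n (min_degree V E)"
  proof
    fix a b c d
    assume adj: "{a, b} \<in> E" "{a, c} \<in> E" "{a, d} \<in> E" "{b, c} \<in> E" "{b, d} \<in> E" "{c, d} \<in> E"
    have ne: "a \<noteq> b" "a \<noteq> c" "a \<noteq> d" "b \<noteq> c" "b \<noteq> d" "c \<noteq> d" using adj edge(3) by blast+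
    then have "card {a, b, c, d} = 4" by simp
    moreover have "{a, b, c, d} \<subseteq> V" using adj edge(1,2) by blast
    moreover have "\<forall>u\<in>{a, b, c, d}. \<forall>v\<in>{a, b, c, d}. u \<noteq> v \<longrightarrow> {u, v} \<in> E"
      using adj by (auto simp: insert_commute)
    ultimately show False using K unfolding contains_complete_def by blast
  next
    show "\<not> {u, v} \<in> E" if "A \<in> P" "u \<in> A" "v \<in> A" for A u v
      using P(4)[OF that(1)] that unfolding independent_set_def by blast
  next
    fix v assume "v \<in> V"
    then show "min_degree V E \<le> card (nb v)"
      unfolding min_degree_def nb_def vertex_degree_eq[OF sg, symmetric] using fin by simp
  qed (use P in auto)
  then show ?thesis using P(2) by blast
qed

text \<open>The maximum is meaningful only for a finite nonempty set: the upper bound supplies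
  finiteness, the construction supplies an element.\<close>

lemma max_min_degree_eqI:
  assumes upper: "\<And>(V :: nat set) E P. balanced_K4_free V (\<lambda>u v. {u, v} \<in> E) P n (min_degree V E) \<Longrightarrow>
      card P = r \<Longrightarrow> min_degree V E \<le> F"
    and lower: "\<exists>(V :: nat set) E. balanced_multipartite n r V E \<and> \<not> contains_complete 4 V E \<and> F \<le> min_degree V E"
  shows "max_min_degree n r 4 = F"
proof -
  define S where "S = {min_degree V E | (V :: nat set) E. balanced_multipartite n r V E \<and> \<not> contains_complete 4 V E}"
  have le: "k \<le> F" if "k \<in> S" for k
    using that balanced_K4_free_of_graph upper unfolding S_def by blast
  then have "finite S" using finite_subset[of S "{..F}"] by auto
  moreover obtain k where "k \<in> S" "F \<le> k" using lower unfolding S_def by blast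
  then have "F \<in> S" using le[of k] by simp
  ultimately show ?thesis
    unfolding max_min_degree_def S_def[symmetric] using le by (intro Max_eqI) auto
qed

section \<open>Constructions\<close>

lemma card_div_mod:
  fixes Q :: "nat \<Rightarrow> nat \<Rightarrow> bool"
  assumes "n > 0"
  shows "card {u. u < r * n \<and> Q (u div n) (u mod n)} = (\<Sum>j<r. card {y. y < n \<and> Q j y})"
proof -
  have "bij_betw (\<lambda>(j, y). j * n + y) (SIGMA j:{..<r}. {y. y < n \<and> Q j y})
      {u. u < r * n \<and> Q (u div n) (u mod n)}"
    (is "bij_betw ?f ?A ?B")
  proof (rule bij_betw_byWitness[where f' = "\<lambda>u. (u div n, u mod n)"])
    have "j * n + y < r * n" if "j < r" "y < n" for j y
    proof -
      have "j * n + y < Suc j * n" using that by simp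
      also have "\<dots> \<le> r * n" using that by (intro mult_le_mono1) simp
      finally show ?thesis .
    qed
    then show "?f ` ?A \<subseteq> ?B" by auto
    show "(\<lambda>u. (u div n, u mod n)) ` ?B \<subseteq> ?A"
      using assms by (auto simp: less_mult_imp_div_less)
  qed (use assms in auto)
  then have "card ?B = card ?A" by (rule bij_betw_same_card[symmetric])
  also have "\<dots> = (\<Sum>j<r. card {y. y < n \<and> Q j y})" by (subst card_SigmaI) auto
  finally show ?thesis .
qed

text \<open>Graphs on \<open>{..<r * n}\<close>: the vertex \<open>u\<close> is the element \<open>u mod n\<close> of the part \<open>u div n\<close>.\<close>

definition part_edges where
  "part_edges n r R = {{u, v} | u v. u < r * n \<and> v < r * n \<and> u div n \<noteq> v div n \<and>
     R (u div n) (u mod n) (v div n) (v mod n)}" for n r :: nat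

context
  fixes n r :: nat and R :: "nat \<Rightarrow> nat \<Rightarrow> nat \<Rightarrow> nat \<Rightarrow> bool"
  assumes n: "n > 0" and R_sym: "\<forall>i x j y. R i x j y \<longrightarrow> R j y i x"
begin

lemma part_edges_iff:
  "{u, v} \<in> part_edges n r R \<longleftrightarrow> u < r * n \<and> v < r * n \<and> u div n \<noteq> v div n \<and>
     R (u div n) (u mod n) (v div n) (v mod n)"
  unfolding part_edges_def by (auto simp: doubleton_eq_iff intro: R_sym[rule_format])

lemma simple_graph_part_edges: "simple_graph {..<r * n} (part_edges n r R)"
  unfolding simple_graph_def part_edges_def by (auto simp: card_insert_if)

lemma balanced_part_edges: "balanced_multipartite n r {..<r * n} (part_edges n r R)"
proof -
  define A where "A i = {u. u < r * n \<and> u div n = i}" for i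
  have card_A: "card (A i) = n" if "i < r" for i
  proof -
    have "card (A i) = (\<Sum>j<r. card {y. y < n \<and> j = i})"
      unfolding A_def using card_div_mod[OF n, of r "\<lambda>j y. j = i"] .
    also have "\<dots> = (\<Sum>j<r. if j = i then n else 0)" by (rule sum.cong) simp_all
    finally show ?thesis using that by simp
  qed
  have ne: "A i \<noteq> {}" if "i < r" for i using card_A[OF that] n by auto
  have inj: "inj_on A {..<r}"
  proof
    fix i j assume ij: "i \<in> {..<r}" "j \<in> {..<r}" "A i = A j"
    have "A i \<noteq> {}" using ne ij(1) by blast
    then obtain u where "u \<in> A i" by blast
    moreover from this have "u \<in> A j" using ij(3) by blast
    ultimately show "i = j" unfolding A_def by simp
  qed
  have "partition_on {..<r * n} (A ` {..<r})"
  proof (rule partition_onI)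
    show "\<Union> (A ` {..<r}) = {..<r * n}"
      unfolding A_def by (auto simp: less_mult_imp_div_less)
    show "disjnt p q" if "p \<in> A ` {..<r}" "q \<in> A ` {..<r}" "p \<noteq> q" for p q
      using that unfolding A_def disjnt_def by auto
    show "{} \<notin> A ` {..<r}" using ne by auto
  qed
  moreover have "card (A ` {..<r}) = r" using inj by (simp add: card_image)
  moreover have "\<forall>C\<in>A ` {..<r}. card C = n \<and> independent_set (part_edges n r R) C"
    using card_A unfolding independent_set_def part_edges_iff A_def by auto
  ultimately show ?thesis
    unfolding balanced_multipartite_def using simple_graph_part_edges by blast
qed

lemma min_degree_part_edges:
  assumes "r > 0"
    and deg: "\<And>i x. i < r \<Longrightarrow> x < n \<Longrightarrow> F \<le> (\<Sum>j<r. card {y. y < n \<and> i \<noteq> j \<and> R i x j y})"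
  shows "F \<le> min_degree {..<r * n} (part_edges n r R)"
proof -
  have "F \<le> vertex_degree (part_edges n r R) v" if "v < r * n" for v
  proof -
    have "F \<le> (\<Sum>j<r. card {y. y < n \<and> v div n \<noteq> j \<and> R (v div n) (v mod n) j y})"
      using that n by (intro deg) (auto simp: less_mult_imp_div_less)
    also have "\<dots> = card {u. u < r * n \<and> v div n \<noteq> u div n \<and> R (v div n) (v mod n) (u div n) (u mod n)}"
      using card_div_mod[OF n, of r "\<lambda>j y. v div n \<noteq> j \<and> R (v div n) (v mod n) j y"] by simp
    also have "\<dots> = vertex_degree (part_edges n r R) v"
      unfolding vertex_degree_eq[OF simple_graph_part_edges] part_edges_iff using that by simp
    finally show ?thesis .
  qed
  moreover have "{..<r * n} \<noteq> {}" using assms(1) n by (auto simp: lessThan_empty_iff)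
  ultimately show ?thesis unfolding min_degree_def by (subst Min_ge_iff) auto
qed

lemma clique_part_edges:
  assumes "contains_complete 4 {..<r * n} (part_edges n r R)"
  obtains i1 i2 i3 i4 x1 x2 x3 x4 where
    "i1 < r" "i2 < r" "i3 < r" "i4 < r" "x1 < n" "x2 < n" "x3 < n" "x4 < n"
    "distinct [i1, i2, i3, i4]"
    "R i1 x1 i2 x2" "R i1 x1 i3 x3" "R i1 x1 i4 x4" "R i2 x2 i3 x3" "R i2 x2 i4 x4" "R i3 x3 i4 x4"
proof -
  obtain K where K: "K \<subseteq> {..<r * n}" "card K = 4"
    "\<And>u v. u \<in> K \<Longrightarrow> v \<in> K \<Longrightarrow> u \<noteq> v \<Longrightarrow> {u, v} \<in> part_edges n r R"
    using assms unfolding contains_complete_def by auto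
  obtain a b c d where abcd: "K = {a, b, c, d}" "a \<noteq> b" "a \<noteq> c" "a \<noteq> d" "b \<noteq> c" "b \<noteq> d" "c \<noteq> d"
    using card_4_E[OF K(2)] .
  have e: "{a, b} \<in> part_edges n r R" "{a, c} \<in> part_edges n r R" "{a, d} \<in> part_edges n r R"
    "{b, c} \<in> part_edges n r R" "{b, d} \<in> part_edges n r R" "{c, d} \<in> part_edges n r R"
    using K(3) abcd by simp_all
  have lt: "u div n < r" "u mod n < n" if "u < r * n" for u
    using that n by (auto simp: less_mult_imp_div_less)
  show thesis
    by (rule that[of "a div n" "b div n" "c div n" "d div n" "a mod n" "b mod n" "c mod n" "d mod n"])
      (use e lt in \<open>simp_all add: part_edges_iff\<close>)
qed

end

text \<open>Vertices of different parts are joined when their colours differ, so four pairwise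
  adjacent vertices would need four colours. A vertex misses its part and its colour class, whose
  overlap is counted only once; this is the degree condition.\<close>

lemma coloured_witness:
  fixes n r F :: nat and col :: "nat \<Rightarrow> nat \<Rightarrow> nat"
  assumes n: "n > 0" and r: "r > 0" and col: "\<And>i x. col i x < 3"
    and deg: "\<And>i x. i < r \<Longrightarrow> x < n \<Longrightarrow>
      F + (\<Sum>j<r. card {y. y < n \<and> col j y = col i x}) \<le> (r - 1) * n + card {y. y < n \<and> col i y = col i x}"
  shows "\<exists>(V :: nat set) E. balanced_multipartite n r V E \<and> \<not> contains_complete 4 V E \<and> F \<le> min_degree V E"
proof -
  define R where "R i x j y \<longleftrightarrow> col i x \<noteq> col j y" for i x j y
  have R_sym: "\<forall>i x j y. R i x j y \<longrightarrow> R j y i x" unfolding R_def by simp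
  have "F \<le> min_degree {..<r * n} (part_edges n r R)"
  proof (rule min_degree_part_edges[OF n R_sym r])
    fix i x assume ix: "i < r" "x < n"
    define a where "a j = card {y. y < n \<and> col j y = col i x}" for j
    have compl: "card {y. y < n \<and> col i x \<noteq> col j y} + a j = n" for j
    proof -
      have "card ({y. y < n \<and> col i x \<noteq> col j y} \<union> {y. y < n \<and> col j y = col i x}) =
          card {y. y < n \<and> col i x \<noteq> col j y} + a j"
        unfolding a_def by (rule card_Un_disjoint) auto
      moreover have "{y. y < n \<and> col i x \<noteq> col j y} \<union> {y. y < n \<and> col j y = col i x} = {..<n}" by auto
      ultimately show ?thesis by simp
    qed
    have "(\<Sum>j<r. card {y. y < n \<and> i \<noteq> j \<and> R i x j y}) + (\<Sum>j<r. a j) + n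
        = (\<Sum>j<r. card {y. y < n \<and> i \<noteq> j \<and> R i x j y} + a j + (if j = i then n else 0))"
      using ix by (simp add: sum.distrib)
    also have "\<dots> = (\<Sum>j<r. n + (if j = i then a i else 0))"
      by (rule sum.cong) (use compl in \<open>auto simp: R_def\<close>)
    also have "\<dots> = r * n + a i" using ix by (simp add: sum.distrib)
    finally have "(\<Sum>j<r. card {y. y < n \<and> i \<noteq> j \<and> R i x j y}) + (\<Sum>j<r. a j) + n = r * n + a i" .
    moreover have "r * n = (r - 1) * n + n" using r by (cases r) auto
    ultimately show "F \<le> (\<Sum>j<r. card {y. y < n \<and> i \<noteq> j \<and> R i x j y})"
      using deg[OF ix] unfolding a_def[symmetric] by linarith
  qed
  moreover have "\<not> contains_complete 4 {..<r * n} (part_edges n r R)"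
  proof
    assume "contains_complete 4 {..<r * n} (part_edges n r R)"
    then obtain i1 i2 i3 i4 x1 x2 x3 x4 where
      "i1 < r" "i2 < r" "i3 < r" "i4 < r" "x1 < n" "x2 < n" "x3 < n" "x4 < n"
      and i: "distinct [i1, i2, i3, i4]"
      and R: "R i1 x1 i2 x2" "R i1 x1 i3 x3" "R i1 x1 i4 x4" "R i2 x2 i3 x3" "R i2 x2 i4 x4" "R i3 x3 i4 x4"
      by (rule clique_part_edges[where R = R, OF n R_sym])
    show False
      using R col[of i1 x1] col[of i2 x2] col[of i3 x3] col[of i4 x4] unfolding R_def by linarith
  qed
  ultimately show ?thesis using balanced_part_edges[OF n R_sym] by blast
qed

text \<open>Whole parts are coloured cyclically, so a colour class has at most
  \<open>(r + 2) div 3\<close> parts, the ceiling of r/3.\<close>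

lemma tripartite_witness:
  fixes n r :: nat
  assumes n: "n > 0" and r: "r > 0"
  shows "\<exists>(V :: nat set) E. balanced_multipartite n r V E \<and> \<not> contains_complete 4 V E \<and>
    (r - (r + 2) div 3) * n \<le> min_degree V E"
proof (rule coloured_witness[OF n r, where col = "\<lambda>i x. i mod 3"])
  fix i x assume ix: "i < r" "x < n"
  have "(\<Sum>j<r. card {y. y < n \<and> j mod 3 = i mod 3}) = (\<Sum>j<r. if j mod 3 = i mod 3 then n else 0)"
    by (rule sum.cong) auto
  also have "\<dots> = card {j. j < r \<and> j mod 3 = i mod 3} * n"
    by (simp add: sum.If_cases Int_def)
  also have "card {j. j < r \<and> j mod 3 = i mod 3} \<le> card {..<(r + 2) div 3}"
  proof (rule card_inj_on_le[where f = "\<lambda>j. j div 3"])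
    show "inj_on (\<lambda>j. j div 3) {j. j < r \<and> j mod 3 = i mod 3}"
      by (rule inj_onI) (metis (mono_tags, lifting) div_mult_mod_eq mem_Collect_eq)
    show "(\<lambda>j. j div 3) ` {j. j < r \<and> j mod 3 = i mod 3} \<subseteq> {..<(r + 2) div 3}" by auto
  qed simp
  finally have "(\<Sum>j<r. card {y. y < n \<and> j mod 3 = i mod 3}) \<le> (r + 2) div 3 * n" by simp
  moreover have "(r - (r + 2) div 3) * n + (r + 2) div 3 * n = (r - 1) * n + n"
  proof -
    have "(r + 2) div 3 \<le> r" using r by simp
    then have "(r - (r + 2) div 3) * n + (r + 2) div 3 * n = r * n"
      by (metis add_mult_distrib le_add_diff_inverse2)
    then show ?thesis using r by (cases r) auto
  qed
  ultimately show "(r - (r + 2) div 3) * n + (\<Sum>j<r. card {y. y < n \<and> j mod 3 = i mod 3})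
      \<le> (r - 1) * n + card {y. y < n \<and> i mod 3 = i mod 3}" by simp
qed simp

text \<open>The parts form two pairs, and the first \<open>k\<close> vertices of each part are
  called low. Two low vertices within a pair, and two high vertices from different pairs, are
  non-adjacent. A K4 would use all four parts and need a high vertex in each pair, but those are
  non-adjacent. Outside its own part a low vertex misses \<open>k\<close> vertices and a high one
  \<open>2 * (n - k)\<close>, which is at most \<open>k\<close>.\<close>

lemma witness_4:
  fixes n k :: nat
  assumes n: "n > 0" and k: "k \<le> n" "2 * n \<le> 3 * k"
  shows "\<exists>(V :: nat set) E. balanced_multipartite n 4 V E \<and> \<not> contains_complete 4 V E \<and>
    3 * n - k \<le> min_degree V E"
proof -
  define R where "R i x j y \<longleftrightarrow> (if (i < 2) = (j < 2) then \<not> (x < k \<and> y < k) else x < k \<or> y < k)"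
    for i x j y :: nat
  have R_sym: "\<forall>i x j y. R i x j y \<longrightarrow> R j y i x" unfolding R_def by (auto split: if_splits)
  have "3 * n - k \<le> min_degree {..<4 * n} (part_edges n 4 R)"
  proof (rule min_degree_part_edges[OF n R_sym])
    fix i x :: nat assume ix: "i < 4" "x < n"
    have c: "card {y. y < n \<and> y < k} = k" "card {y. y < n \<and> \<not> y < k} = n - k" "card {y. y < n} = n"
    proof -
      have "{y. y < n \<and> y < k} = {..<k}" "{y. y < n \<and> \<not> y < k} = {k..<n}" using k by auto
      then show "card {y. y < n \<and> y < k} = k" "card {y. y < n \<and> \<not> y < k} = n - k" "card {y. y < n} = n"
        by simp_all
    qed
    have "(\<Sum>j<4. card {y. y < n \<and> i \<noteq> j \<and> R i x j y}) =
        (\<Sum>j\<leftarrow>[0,1,2,3]. card {y. y < n \<and> i \<noteq> j \<and> R i x j y})"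
      by (simp add: eval_nat_numeral)
    moreover have "i = 0 \<or> i = 1 \<or> i = 2 \<or> i = 3" using ix by linarith
    ultimately show "3 * n - k \<le> (\<Sum>j<4. card {y. y < n \<and> i \<noteq> j \<and> R i x j y})"
      using k c unfolding R_def by (cases "x < k") auto
  next
    show "0 < (4::nat)" by simp
  qed
  moreover have "\<not> contains_complete 4 {..<4 * n} (part_edges n 4 R)"
  proof
    assume "contains_complete 4 {..<4 * n} (part_edges n 4 R)"
    then obtain i1 i2 i3 i4 x1 x2 x3 x4 where 
      i4: "i1 < 4" "i2 < 4" "i3 < 4" "i4 < 4" "x1 < n" "x2 < n" "x3 < n" "x4 < n"
      and i: "distinct [i1, i2, i3, i4]"
      and R: "R i1 x1 i2 x2" "R i1 x1 i3 x3" "R i1 x1 i4 x4" "R i2 x2 i3 x3" "R i2 x2 i4 x4" "R i3 x3 i4 x4"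
      by (rule clique_part_edges[where R = R, OF n R_sym])
    have "i1 = 0 \<or> i1 = 1 \<or> i1 = 2 \<or> i1 = 3" "i2 = 0 \<or> i2 = 1 \<or> i2 = 2 \<or> i2 = 3"
      "i3 = 0 \<or> i3 = 1 \<or> i3 = 2 \<or> i3 = 3" "i4 = 0 \<or> i4 = 1 \<or> i4 = 2 \<or> i4 = 3"
      using i4 by linarith+
    then show False using i R unfolding R_def by (elim disjE) (auto split: if_splits)
  qed
  ultimately show ?thesis using balanced_part_edges[OF n R_sym, of 4] by blast
qed

section \<open>Extremal matrices for \<open>r = 3 * M + 1\<close>\<close>

lemma sum_lessThan_add:
  fixes f :: "nat \<Rightarrow> nat"
  shows "(\<Sum>j<a + b. f j) = (\<Sum>j<a. f j) + (\<Sum>j<b. f (a + j))"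
  by (induction b) (auto simp: add.assoc)

text \<open>Parts \<open>i < M + 1\<close> have colours 0 and 2, the next \<open>M + 1\<close> parts have colours 1 and 2,
  and the remaining \<open>M - 1\<close> parts are entirely of colour 2.\<close>

lemma mod_1_witness:
  fixes n M e c :: nat and b :: "nat \<Rightarrow> nat"
  assumes n: "n > 0" and M: "M \<ge> 2"
    and b: "\<And>i. i \<le> M \<Longrightarrow> b i \<le> c" and c: "c \<le> n" "3 * e + 2 * c \<le> 2 * n"
    and sum_b: "(\<Sum>i<M + 1. b i) = e + c"
    and pos: "\<And>i. i \<le> M \<Longrightarrow> b i > 0 \<Longrightarrow> 3 * e + 2 * c \<le> n + b i"
  shows "\<exists>(V :: nat set) E. balanced_multipartite n (3 * M + 1) V E \<and> \<not> contains_complete 4 V E \<and>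
    2 * M * n + e \<le> min_degree V E"
proof -
  define col :: "nat \<Rightarrow> nat \<Rightarrow> nat" where "col i x =
    (if i < M + 1 then if x < b i then 2 else 0
     else if i < 2 * (M + 1) then if x < b (i - (M + 1)) then 2 else 1
     else 2)" for i x
  define a where "a k j = card {y. y < n \<and> col j y = k}" for k j
  have bn: "b i \<le> n" if "i \<le> M" for i using b[OF that] c by simp
  have lt: "card {y. y < n \<and> y < t} = t" "card {y. y < n \<and> \<not> y < t} = n - t" if "t \<le> n" for t
  proof -
    have "{y. y < n \<and> y < t} = {..<t}" "{y. y < n \<and> \<not> y < t} = {t..<n}" using that by auto
    then show "card {y. y < n \<and> y < t} = t" "card {y. y < n \<and> \<not> y < t} = n - t" by simp_all
  qed
  have a1: "a 0 j = n - b j" "a 1 j = 0" "a 2 j = b j" if "j < M + 1" for j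
  proof -
    have "{y. y < n \<and> col j y = 0} = {y. y < n \<and> \<not> y < b j}" "{y. y < n \<and> col j y = 1} = {}"
      "{y. y < n \<and> col j y = 2} = {y. y < n \<and> y < b j}"
      using that unfolding col_def by auto
    then show "a 0 j = n - b j" "a 1 j = 0" "a 2 j = b j"
      using lt[OF bn[of j]] that unfolding a_def by simp_all
  qed
  have a2: "a 0 (M + 1 + j) = 0" "a 1 (M + 1 + j) = n - b j" "a 2 (M + 1 + j) = b j" if "j < M + 1" for j
  proof -
    have "{y. y < n \<and> col (M + 1 + j) y = 0} = {}"
      "{y. y < n \<and> col (M + 1 + j) y = 1} = {y. y < n \<and> \<not> y < b j}"
      "{y. y < n \<and> col (M + 1 + j) y = 2} = {y. y < n \<and> y < b j}"
      using that unfolding col_def by auto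
    then show "a 0 (M + 1 + j) = 0" "a 1 (M + 1 + j) = n - b j" "a 2 (M + 1 + j) = b j"
      using lt[OF bn[of j]] that unfolding a_def by simp_all
  qed
  have a3: "a 0 (M + 1 + (M + 1 + j)) = 0" "a 1 (M + 1 + (M + 1 + j)) = 0" "a 2 (M + 1 + (M + 1 + j)) = n" for j
    unfolding a_def col_def by auto
  have r: "3 * M + 1 = M + 1 + (M + 1 + (M - 1))" using M by simp
  have comp: "(\<Sum>j<M + 1. n - b j) + (e + c) = (M + 1) * n"
  proof -
    have "(\<Sum>j<M + 1. n - b j) + (\<Sum>j<M + 1. b j) = (\<Sum>j<M + 1. n)"
      unfolding sum.distrib[symmetric] by (rule sum.cong) (use bn in auto)
    then show ?thesis using sum_b by simp
  qed
  have s0: "(\<Sum>j<3 * M + 1. a 0 j) + (e + c) = (M + 1) * n"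
    unfolding r sum_lessThan_add[of _ "M + 1"] using comp by (simp add: a1 a2 a3 del: One_nat_def sum.lessThan_Suc)
  have s1: "(\<Sum>j<3 * M + 1. a 1 j) + (e + c) = (M + 1) * n"
    unfolding r sum_lessThan_add[of _ "M + 1"] using comp by (simp add: a1 a2 a3 del: One_nat_def sum.lessThan_Suc)
  have s2: "(\<Sum>j<3 * M + 1. a 2 j) = 2 * (e + c) + (M - 1) * n"
    unfolding r sum_lessThan_add[of _ "M + 1"] using sum_b by (simp add: a1 a2 a3 del: One_nat_def sum.lessThan_Suc)
  have Mn: "(M - 1) * n + n = M * n" using M by (cases M) auto
  show ?thesis
  proof (rule coloured_witness[where col = col])
    fix i x assume ix: "i < 3 * M + 1" "x < n"
    consider j where "i = j" "j < M + 1" | j where "i = M + 1 + j" "j < M + 1"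
      | j where "i = M + 1 + (M + 1 + j)"
      by (metis add.assoc le_Suc_ex less_add_same_cancel1 linorder_not_le nat_add_left_cancel_less)
    \<comment> \<open>Each numerical hypothesis is one degree condition: \<open>pos\<close> for
      colour 2 in a mixed part, \<open>b i \<le> c\<close> for colours 0 and 1, and
      \<open>3 * e + 2 * c \<le> 2 * n\<close> for the parts entirely of colour 2.\<close>
    then have "2 * (M * n) + e + (\<Sum>j<3 * M + 1. a (col i x) j) \<le> 3 * (M * n) + a (col i x) i"
    proof cases
      case 1
      show ?thesis
      proof (cases "x < b j")
        case True
        then have "col i x = 2" using 1 unfolding col_def by simp
        then show ?thesis using s2 a1(3)[OF 1(2)] pos[of j] 1 True Mn by simp
      next
        case False
        then have "col i x = 0" using 1 unfolding col_def by simp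
        then show ?thesis using s0 a1(1)[OF 1(2)] b[of j] bn[of j] 1 by simp
      qed
    next
      case 2
      show ?thesis
      proof (cases "x < b j")
        case True
        then have "col i x = 2" using 2 unfolding col_def by simp
        then show ?thesis using s2 a2(3)[OF 2(2)] pos[of j] 2 True Mn by simp
      next
        case False
        then have "col i x = 1" using 2 unfolding col_def by simp
        then show ?thesis using s1 a2(2)[OF 2(2)] b[of j] bn[of j] 2 by simp
      qed
    next
      case 3
      then have "col i x = 2" unfolding col_def by simp
      then show ?thesis using s2 a3(3) 3 c Mn by simp
    qed
    then show "2 * M * n + e + (\<Sum>j<3 * M + 1. card {y. y < n \<and> col j y = col i x})
        \<le> (3 * M + 1 - 1) * n + card {y. y < n \<and> col i y = col i x}"
      unfolding a_def by (simp add: mult.assoc)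
  qed (use n in \<open>simp_all add: col_def\<close>)
qed

section \<open>The values of the extremal function\<close>

lemma sum_if_less:
  fixes x y :: nat
  assumes "k \<le> N"
  shows "(\<Sum>i<N. if i < k then x else y) = k * x + (N - k) * y"
proof -
  obtain l where "N = k + l" using assms le_Suc_ex by blast
  then show ?thesis by (simp add: sum_lessThan_add)
qed

text \<open>The tight shape: all positive shared entries equal \<open>c\<close>, and there are
  \<open>e div c + 1\<close> of them in each block to reach the sum \<open>e + c\<close>.\<close>

lemma mod_1_witness_dvd:
  assumes n: "n > 0" and M: "M \<ge> 2" and c: "c \<ge> 1" "c dvd e" "e \<le> M * c" "3 * e + c \<le> n"
  shows "\<exists>(V :: nat set) E. balanced_multipartite n (3 * M + 1) V E \<and> \<not> contains_complete 4 V E \<and>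
    2 * M * n + e \<le> min_degree V E"
proof (rule mod_1_witness[OF n M, where b = "\<lambda>i. if i < e div c + 1 then c else 0" and c = c])
  have "e div c \<le> M" using c by (metis div_le_mono nonzero_mult_div_cancel_right not_one_le_zero)
  then have "(\<Sum>i<M + 1. if i < e div c + 1 then c else 0) = (e div c + 1) * c"
    by (subst sum_if_less) auto
  also have "\<dots> = e + c" using c(2) by simp
  finally show "(\<Sum>i<M + 1. if i < e div c + 1 then c else 0) = e + c" .
qed (use c in \<open>auto split: if_splits\<close>)

text \<open>Without divisibility the entries are \<open>c\<close> and \<open>c - 1\<close>. The
  smaller value weakens the condition on colour 2 by one, which is why \<open>n\<close> must exceed
  \<open>3 * e + c\<close>.\<close>

lemma mod_1_witness_not_dvd:
  assumes n: "n > 0" and M: "M \<ge> 2" and c: "c \<ge> 2" "e \<le> M * c" "M * c \<le> e + M + 1" "3 * e + c + 1 \<le> n"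
  shows "\<exists>(V :: nat set) E. balanced_multipartite n (3 * M + 1) V E \<and> \<not> contains_complete 4 V E \<and>
    2 * M * n + e \<le> min_degree V E"
proof -
  obtain s where s: "M * c = e + s" "s \<le> M + 1" using c le_Suc_ex[OF c(2)] by auto
  show ?thesis
  proof (rule mod_1_witness[OF n M, where b = "\<lambda>i. if i < s then c - 1 else c" and c = c])
    have "(\<Sum>i<M + 1. if i < s then c - 1 else c) + s = s * (c - 1) + (M + 1 - s) * c + s"
      using s(2) by (subst sum_if_less) auto
    also have "\<dots> = s * (c - 1 + 1) + (M + 1 - s) * c" by (simp add: algebra_simps)
    also have "\<dots> = (M + 1) * c"
      using c(1) s(2) by (simp del: add_Suc_right add: add_mult_distrib[symmetric])
    finally show "(\<Sum>i<M + 1. if i < s then c - 1 else c) = e + c" using s(1) by simp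
  qed (use c in \<open>auto split: if_splits\<close>)
qed

text \<open>The entry size \<open>c\<close> has to be about e/M: it is \<open>q\<close> when
  \<open>h = 0\<close> and \<open>q + 1\<close> otherwise. For \<open>q = 0\<close> the value 1
  divides everything, so equal entries are possible.\<close>

lemma mod_1_witness_quotient:
  assumes n: "n > 0" "n = (3 * M + 1) * q + \<rho>" and M: "M \<ge> 2" and h: "h \<le> M" "h = 0 \<or> 3 * h + 2 \<le> \<rho>"
  shows "\<exists>(V :: nat set) E. balanced_multipartite n (3 * M + 1) V E \<and> \<not> contains_complete 4 V E \<and>
    2 * M * n + (M * q + h) \<le> min_degree V E"
proof -
  have n': "n = 3 * (M * q) + q + \<rho>" using n(2) by (simp add: algebra_simps)
  consider "q = 0" | "q > 0" "h = 0" | "q > 0" "3 * h + 2 \<le> \<rho>" using h by blast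
  then show ?thesis
  proof cases
    case 1
    then show ?thesis
      by (intro mod_1_witness_dvd[where c = 1, OF n(1) M]) (use n n' h in auto)
  next
    case 2
    then show ?thesis
      by (intro mod_1_witness_dvd[where c = q, OF n(1) M]) (use n' in auto)
  next
    case 3
    then show ?thesis
      by (intro mod_1_witness_not_dvd[where c = "q + 1", OF n(1) M]) (use n' h in auto)
  qed
qed

lemma eta_eq:
  assumes "M \<ge> 2"
  shows "eta n (3 * M + 1) = (if \<exists>h. 1 \<le> h \<and> h < M \<and> n mod (3 * M + 1) = 3 * h + 1 \<and>
    \<not> (n div (3 * M + 1) + 1) dvd (M - h) then 1 else 0)"
proof -
  have "(\<exists>m h. m \<ge> 3 \<and> 3 * M + 1 = 3 * m - 2 \<and> 1 \<le> h \<and> h \<le> m - 2 \<and>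
           n mod (3 * M + 1) = 3 * h + 1 \<and> \<not> (n div (3 * M + 1) + 1) dvd (m - h - 1)) \<longleftrightarrow>
      (\<exists>h. 1 \<le> h \<and> h < M \<and> n mod (3 * M + 1) = 3 * h + 1 \<and> \<not> (n div (3 * M + 1) + 1) dvd (M - h))"
    (is "?L \<longleftrightarrow> ?R")
  proof
    assume ?L
    then obtain m h where m: "m \<ge> 3" "3 * M + 1 = 3 * m - 2" and h: "1 \<le> h" "h \<le> m - 2"
      "n mod (3 * M + 1) = 3 * h + 1" "\<not> (n div (3 * M + 1) + 1) dvd (m - h - 1)" by blast
    have "m = M + 1" using m by linarith
    then have "m - h - 1 = M - h" "h < M" using h m by auto
    then show ?R using h by auto
  next
    assume ?R
    then obtain h where h: "1 \<le> h" "h < M" "n mod (3 * M + 1) = 3 * h + 1"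
      "\<not> (n div (3 * M + 1) + 1) dvd (M - h)" by blast
    then show ?L using assms by (intro exI[of _ "M + 1"] exI[of _ h]) auto
  qed
  then show ?thesis unfolding eta_def by simp
qed

text \<open>Adding \<open>eta\<close> on the left avoids truncated subtraction. With n = (3M+1)q +
  3h + t and \<open>e0\<close> the quotient, suppose \<open>e0 > M * q\<close>. The largest shared
  entry is then at least q + 1 and at most n - 3 e0. For t = 1 the two bounds coincide and equal
  entries are forced; for t = 0 and t = 2 there is slack for unequal ones.\<close>

theorem max_min_degree_mod_1:
  fixes n M :: nat
  assumes n: "n \<ge> 1" and M: "M \<ge> 2"
  shows "max_min_degree n (3 * M + 1) 4 + eta n (3 * M + 1) = 2 * M * n + M * n div (3 * M + 1)"
proof -
  define q where "q = n div (3 * M + 1)"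
  define \<rho> where "\<rho> = n mod (3 * M + 1)"
  have n_eq: "n = (3 * M + 1) * q + \<rho>" and \<rho>: "\<rho> < 3 * M + 1"
    unfolding q_def \<rho>_def by (simp_all only: mult_div_mod_eq) simp
  then have n': "n = 3 * (M * q) + q + \<rho>" by (simp add: algebra_simps)
  define h where "h = \<rho> div 3"
  define t where "t = \<rho> mod 3"
  have ht: "\<rho> = 3 * h + t" "t < 3" unfolding h_def t_def by simp_all
  have hM: "h \<le> M" "t > 0 \<Longrightarrow> h < M" using \<rho> ht by linarith+
  define e0 where "e0 = M * n div (3 * M + 1)"
  have Mn: "M * n = (3 * M + 1) * (M * q) + M * \<rho>" unfolding n_eq by (simp add: algebra_simps)
  have div: "e0 = M * q + h'" if "M * \<rho> = (3 * M + 1) * h' + s" "s < 3 * M + 1" for h' s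
  proof -
    have "M * n = s + (M * q + h') * (3 * M + 1)" unfolding Mn that(1) by (simp add: algebra_simps)
    then have "e0 = (s + (M * q + h') * (3 * M + 1)) div (3 * M + 1)" unfolding e0_def by (rule arg_cong)
    also have "\<dots> = M * q + h' + s div (3 * M + 1)" by (rule div_mult_self1) simp
    finally show ?thesis using that(2) by simp
  qed
  \<comment> \<open>M (3h + t) = (3M + 1) h + (t M - h), where the remainder is negative for t = 0
    and h > 0, which costs one. For h = 0 the truncated \<open>h - 1\<close> is the right value
    0.\<close>
  have e0: "e0 = M * q + (if t = 0 then h - 1 else h)"
  proof (cases "t = 0")
    case True
    show ?thesis
    proof (cases h)
      case 0
      then show ?thesis using div[of 0 0] ht True by simp
    next
      case (Suc h')
      have "M * \<rho> = (3 * M + 1) * h' + (3 * M - h')" using ht True Suc hM by (simp add: algebra_simps)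
      then show ?thesis using div[of h' "3 * M - h'"] True Suc by simp
    qed
  next
    case False
    have "M * \<rho> = (3 * M + 1) * h + (t * M - h)"
    proof -
      have "h \<le> t * M" using hM False by (cases t) auto
      then show ?thesis using ht by (simp add: algebra_simps)
    qed
    moreover have "t * M - h < 3 * M + 1"
    proof -
      have "t * M \<le> 3 * M" using ht(2) by (intro mult_le_mono1) simp
      then show ?thesis by linarith
    qed
    ultimately show ?thesis using div[of h "t * M - h"] False by simp
  qed
  define \<eta> where "\<eta> = eta n (3 * M + 1)"
  have \<eta>: "\<eta> = (if t = 1 \<and> 1 \<le> h \<and> \<not> (q + 1) dvd (M - h) then 1 else 0)"
  proof -
    have iff: "(\<exists>k. 1 \<le> k \<and> k < M \<and> \<rho> = 3 * k + 1 \<and> \<not> (q + 1) dvd (M - k)) \<longleftrightarrow>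
        t = 1 \<and> 1 \<le> h \<and> \<not> (q + 1) dvd (M - h)"
    proof
      assume "\<exists>k. 1 \<le> k \<and> k < M \<and> \<rho> = 3 * k + 1 \<and> \<not> (q + 1) dvd (M - k)"
      then obtain k where k: "1 \<le> k" "\<rho> = 3 * k + 1" "\<not> (q + 1) dvd (M - k)" by blast
      have "k = h \<and> t = 1" using k(2) ht by presburger
      then show "t = 1 \<and> 1 \<le> h \<and> \<not> (q + 1) dvd (M - h)" using k by simp
    qed (use ht hM in auto)
    have "\<eta> = (if \<exists>k. 1 \<le> k \<and> k < M \<and> \<rho> = 3 * k + 1 \<and> \<not> (q + 1) dvd (M - k) then 1 else 0)"
      unfolding \<eta>_def eta_eq[OF M] q_def \<rho>_def by (rule refl)
    then show ?thesis
      by (rule back_subst[where P = "\<lambda>b. \<eta> = (if b then 1 else 0)", OF _ iff])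
  qed
  have \<eta>1: "t = 1" "1 \<le> h" "h < M" "\<not> (q + 1) dvd (M - h)" "q \<ge> 1" "e0 = M * q + h" if "\<eta> = 1"
  proof -
    have "t = 1 \<and> 1 \<le> h \<and> \<not> (q + 1) dvd (M - h)"
    proof (rule ccontr)
      assume "\<not> ?thesis"
      then have "\<eta> = 0" unfolding \<eta> by (rule if_not_P)
      with that show False by simp
    qed
    then show 1: "t = 1" "1 \<le> h" "\<not> (q + 1) dvd (M - h)" by blast+
    then show "h < M" "e0 = M * q + h" using hM e0 by auto
    show "q \<ge> 1" using 1 by (cases q) auto
  qed
  have \<eta>01: "\<eta> = 0 \<or> \<eta> = 1" unfolding \<eta> by simp
  have \<eta>_le: "\<eta> \<le> e0"
    using \<eta>01 \<eta>1 by auto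
  have Mh: "M * (q + 1) = (M * q + h) + (M - h)" using hM by simp
  have "max_min_degree n (3 * M + 1) 4 = 2 * M * n + (e0 - \<eta>)"
  proof (rule max_min_degree_eqI)
    fix V :: "nat set" and E P
    assume "balanced_K4_free V (\<lambda>u v. {u, v} \<in> E) P n (min_degree V E)" and P: "card P = 3 * M + 1"
    then interpret balanced_K4_free V "\<lambda>u v. {u, v} \<in> E" P n "min_degree V E" by simp
    have "min_degree V E < 2 * M * n + (e0 + 1 - \<eta>)"
      using \<eta>01
    proof
      assume "\<eta> = 0"
      have less: "M * n < (3 * M + 1) * (e0 + 1)"
        unfolding e0_def by (metis Suc_eq_plus1 dividend_less_times_div less_numeral_extra(1) mult_Suc_right zero_less_Suc add.commute)
      also have "\<dots> \<le> (4 * M) * (e0 + 1)" using M by (intro mult_le_mono1) simp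
      finally have "M * n < M * (4 * (e0 + 1))" by (simp only: mult.assoc mult.left_commute)
      then have "n < 4 * (e0 + 1)" by simp
      moreover have "M * n < (3 * M + 4) * (e0 + 1)" using less by (simp add: algebra_simps)
      ultimately have "min_degree V E < 2 * M * n + (e0 + 1)"
        using degree_bound_mod_1[OF P M n, of "e0 + 1"] less by blast
      then show ?thesis using \<open>\<eta> = 0\<close> by simp
    next
      assume "\<eta> = 1"
      note 1 = \<eta>1[OF this]
      have nq: "n = 3 * e0 + (q + 1)" using n' ht 1 by simp
      have "M \<le> M * q" using 1 by simp
      have "n < 4 * e0" using nq 1 \<open>M \<le> M * q\<close> M mult_le_mono1[OF M, of q] by linarith
      moreover have "M * n < (3 * M + 4) * e0"
      proof -
        have "M * n = 3 * (M * e0) + (M * q + M)" unfolding nq by (simp add: algebra_simps)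
        also have "\<dots> < 3 * (M * e0) + 4 * e0" using 1(2,6) \<open>M \<le> M * q\<close> by linarith
        finally show ?thesis by (simp add: algebra_simps)
      qed
      \<comment> \<open>\<open>e0\<close> and \<open>M - h\<close> add up to a multiple of
        \<open>q + 1\<close>, so the condition in \<open>eta\<close> becomes the one in
        \<open>degree_bound_mod_1\<close> with \<open>c = q + 1\<close>.\<close>
      moreover have "\<not> (q + 1) dvd e0"
        using 1(4,6) Mh by (metis dvd_add_right_iff dvd_triv_right)
      moreover have "M * (q + 1 - 1) < e0" using 1 by simp
      ultimately have "min_degree V E < 2 * M * n + e0"
        using degree_bound_mod_1[OF P M n, of e0] nq by blast
      then show ?thesis using \<open>\<eta> = 1\<close> by simp
    qed
    then show "min_degree V E \<le> 2 * M * n + (e0 - \<eta>)" using \<eta>_le by simp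
  next
    have n0: "n > 0" using n by simp
    show "\<exists>(V :: nat set) E. balanced_multipartite n (3 * M + 1) V E \<and> \<not> contains_complete 4 V E \<and>
      2 * M * n + (e0 - \<eta>) \<le> min_degree V E"
    proof (cases "t = 1 \<and> 1 \<le> h \<and> \<eta> = 0")
      case True
      then have "(q + 1) dvd (M - h)" and e: "e0 = M * q + h" using \<eta> e0 by (auto split: if_splits)
      then have "(q + 1) dvd e0" using Mh by (metis dvd_add_left_iff dvd_triv_right)
      moreover have "3 * e0 + (q + 1) \<le> n" using n' ht e True by simp
      moreover have "e0 \<le> M * (q + 1)" using Mh e by simp
      ultimately show ?thesis using mod_1_witness_dvd[of n M "q + 1" e0] n0 M True by simp
    next
      case False
      \<comment> \<open>Here \<open>h'\<close> is h - 1 (or 0) for t = 0, h for t = 2, h - 1 when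
        \<open>\<eta> = 1\<close>, and 0 when t = 1 and h = 0. In every case it is 0 or leaves the
        slack \<open>3 * h' + 2 \<le> \<rho>\<close>.\<close>
      define h' where "h' = e0 - \<eta> - M * q"
      have h': "e0 - \<eta> = M * q + h'" "h' \<le> M" "h' = 0 \<or> 3 * h' + 2 \<le> \<rho>"
        using False e0 \<eta>01 \<eta>1 ht hM unfolding h'_def by (auto split: if_splits)
      show ?thesis unfolding h'(1) by (rule mod_1_witness_quotient[OF n0 n_eq M h'(2,3)])
    qed
  qed
  then show ?thesis using \<eta>_le unfolding \<eta>_def e0_def by simp
qed

section \<open>The residues 0 and 2, the case \<open>r = 4\<close>, and the combined formula\<close>

theorem max_min_degree_mod_0:
  fixes n k :: nat
  assumes "n \<ge> 1" "k \<ge> 1"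
  shows "max_min_degree n (3 * k) 4 = 2 * k * n"
proof (rule max_min_degree_eqI)
  fix V :: "nat set" and E P
  assume "balanced_K4_free V (\<lambda>u v. {u, v} \<in> E) P n (min_degree V E)" and P: "card P = 3 * k"
  then interpret balanced_K4_free V "\<lambda>u v. {u, v} \<in> E" P n "min_degree V E" by simp
  show "min_degree V E \<le> 2 * k * n" using degree_bound_mod_0 assms P by simp
next
  have "3 * k - (3 * k + 2) div 3 = 2 * k" by simp
  then show "\<exists>(V :: nat set) E. balanced_multipartite n (3 * k) V E \<and> \<not> contains_complete 4 V E \<and>
      2 * k * n \<le> min_degree V E"
    using tripartite_witness[of n "3 * k"] assms by simp
qed

theorem max_min_degree_mod_2:
  fixes n k :: nat
  assumes "n \<ge> 1" "k \<ge> 2"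
  shows "max_min_degree n (3 * k - 1) 4 = (2 * k - 1) * n"
proof (rule max_min_degree_eqI)
  fix V :: "nat set" and E P
  assume "balanced_K4_free V (\<lambda>u v. {u, v} \<in> E) P n (min_degree V E)" and P: "card P = 3 * k - 1"
  then interpret balanced_K4_free V "\<lambda>u v. {u, v} \<in> E" P n "min_degree V E" by simp
  show "min_degree V E \<le> (2 * k - 1) * n" using degree_bound_mod_2 assms P by simp
next
  have "(3 * k - 1) - (3 * k - 1 + 2) div 3 = 2 * k - 1" using assms by linarith
  then show "\<exists>(V :: nat set) E. balanced_multipartite n (3 * k - 1) V E \<and> \<not> contains_complete 4 V E \<and>
      (2 * k - 1) * n \<le> min_degree V E"
    using tripartite_witness[of n "3 * k - 1"] assms by simp
qed

theorem max_min_degree_4: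
  fixes n :: nat
  assumes n: "n \<ge> 1"
  shows "max_min_degree n 4 4 = 3 * n - (2 * n + 2) div 3"
proof (rule max_min_degree_eqI)
  fix V :: "nat set" and E P
  assume "balanced_K4_free V (\<lambda>u v. {u, v} \<in> E) P n (min_degree V E)" and P: "card P = 4"
  then interpret balanced_K4_free V "\<lambda>u v. {u, v} \<in> E" P n "min_degree V E" by simp
  have "3 * ((2 * n + 2) div 3 - 1) < 2 * n" using n by linarith
  from degree_bound_4[OF P this] show "min_degree V E \<le> 3 * n - (2 * n + 2) div 3" by linarith
next
  show "\<exists>(V :: nat set) E. balanced_multipartite n 4 V E \<and> \<not> contains_complete 4 V E \<and>
      3 * n - (2 * n + 2) div 3 \<le> min_degree V E"
    by (rule witness_4) (use n in linarith)+
qed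

lemma ceiling_divide_nat:
  fixes a b :: nat
  assumes "b > 0"
  shows "\<lceil>real a / real b\<rceil> = int ((a + b - 1) div b)"
proof -
  define z where "z = (a + b - 1) div b"
  define s where "s = (a + b - 1) mod b"
  have "a + b - 1 = z * b + s" "s < b" unfolding z_def s_def using assms by simp_all
  then have "a \<le> z * b" "z * b < a + b" using assms by linarith+
  then have "real a \<le> real z * real b" "real z * real b < real a + real b"
    by (simp_all only: of_nat_mult[symmetric] of_nat_add[symmetric] of_nat_le_iff of_nat_less_iff)
  then have "\<lceil>real a / real b\<rceil> = int z"
    using assms by (intro ceiling_unique) (simp_all add: field_simps)
  then show ?thesis unfolding z_def .
qed

theorem corollary5p3:
  fixes n r :: nat
  assumes "n \<ge> 1" and "r \<ge> 4"
  shows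
    "(r = 4 \<longrightarrow>
        int (max_min_degree n r 4) = 3 * int n - \<lceil>2 * real n / 3\<rceil>) \<and>
     (r \<ge> 6 \<and> [r = 0] (mod 3) \<longrightarrow>
        real (max_min_degree n r 4) = (2 * real r / 3) * real n) \<and>
     ([r = 2] (mod 3) \<longrightarrow>
        int (max_min_degree n r 4) = (int r - \<lceil>real r / 3\<rceil>) * int n) \<and>
     (\<forall>m\<ge>3. r = 3 * m - 2 \<longrightarrow>
        int (max_min_degree n r 4) =
          (int r - 1) * int n
          - \<lceil>(real m - 1) * (real r - 1) * real n / real r\<rceil>
          - int (eta n r))"
proof (intro conjI impI allI)
  assume "r = 4"
  moreover have "\<lceil>2 * real n / 3\<rceil> = int ((2 * n + 2) div 3)"
    using ceiling_divide_nat[of 3 "2 * n"] by simp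
  moreover have "(2 * n + 2) div 3 \<le> 3 * n" using assms(1) by linarith
  ultimately show "int (max_min_degree n r 4) = 3 * int n - \<lceil>2 * real n / 3\<rceil>"
    using max_min_degree_4[OF assms(1)] by simp
next
  assume r: "r \<ge> 6 \<and> [r = 0] (mod 3)"
  then obtain k where "r = 3 * k" by (auto simp: cong_0_iff)
  then show "real (max_min_degree n r 4) = (2 * real r / 3) * real n"
    using max_min_degree_mod_0[of n k] assms(1) r by simp
next
  assume "[r = 2] (mod 3)"
  then have "r mod 3 = 2" by (simp add: cong_def)
  then obtain k where k: "r = 3 * k - 1" "k \<ge> 2"
    using assms(2) by (intro that[of "r div 3 + 1"]) presburger+
  have "\<lceil>real r / 3\<rceil> = int k"
    using ceiling_divide_nat[of 3 r] k by simp
  then show "int (max_min_degree n r 4) = (int r - \<lceil>real r / 3\<rceil>) * int n"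
    using max_min_degree_mod_2[OF assms(1) k(2)] k by (simp add: of_nat_diff)
next
  fix m assume m: "3 \<le> m" and r: "r = 3 * m - 2"
  define M where "M = m - 1"
  have M: "m = M + 1" "M \<ge> 2" "r = 3 * M + 1" using m r unfolding M_def by auto
  define e where "e = M * n div (3 * M + 1)"
  define s where "s = M * n mod (3 * M + 1)"
  have "M * n = e * (3 * M + 1) + s" "s < 3 * M + 1"
    unfolding e_def s_def by (simp_all only: div_mult_mod_eq) simp
  then have "e * (3 * M + 1) \<le> M * n" "M * n < (e + 1) * (3 * M + 1)" by simp_all
  then have "real (e * (3 * M + 1)) \<le> real (M * n)" "real (M * n) < real ((e + 1) * (3 * M + 1))"
    by (simp_all only: of_nat_le_iff of_nat_less_iff)
  \<comment> \<open>The quotient M (3M) n / (3M + 1) equals M n - M n / (3M + 1), so the ceiling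
    turns into the floor \<open>e\<close>, and 3 M n minus it is 2 M n + e.\<close>
  then have ceil: "\<lceil>(real m - 1) * (real r - 1) * real n / real r\<rceil> = int (M * n) - int e"
    unfolding M(1,3) by (intro ceiling_unique) (simp_all add: field_simps)
  have "int (max_min_degree n r 4 + eta n r) = int (2 * M * n + e)"
    using max_min_degree_mod_1[OF assms(1) M(2)] unfolding M(3) e_def by (rule arg_cong)
  then show "int (max_min_degree n r 4) =
      (int r - 1) * int n - \<lceil>(real m - 1) * (real r - 1) * real n / real r\<rceil> - int (eta n r)"
    unfolding ceil using M(3) by (simp add: algebra_simps)
qed

end
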